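(* Let $N\ge1$, $T>0$, $Q_T=\mathbb{R}^N\times(0,T]$, $\bar Q_T=\mathbb{R}^N\times[0,T]$, $\sigma\in(0,1]$. Let $K^\sigma:\mathbb{R}^N\to\mathbb{R}$ be nonnegative and measurable and such that $\bar k(z):=K^\sigma(z)|z|^{N+\sigma}$ is bounded on $\mathbb{R}^N$, continuous at the origin, with $\bar k(0)>0$. Let $F\in C(\mathbb{R}^N\times\mathbb{R}^N\times\mathbb{R})$ satisfy: (1) there are $n>0$, $m>1$ and a modulus of continuity $\omega$ such that for all $x_i,p_i\in\mathbb{R}^N$, $l_i\in\mathbb{R}$, $i=1,2$, $$|F(x_1,p_1,l_1)-F(x_2,p_2,l_2)|\le\omega\Big(|l_1-l_2|+|x_1-x_2|(1+|l|+|p|^m)^n+|p_1-p_2|(1+|l|+|p|^m)^n\Big),$$ where $|p|=\max\{|p_1|,|p_2|\}$, $|l|=\max\{|l_1|,|l_2|\}$; (2) (degenerate ellipticity in the nonlocal variable) $F(x,p,l_1)\le F(x,p,l_2)$ for all $x,p\in\mathbb{R}^N$ and $l_1\ge l_2$; (3) (superlinearity in the gradient) there exist $m'>1$ and $C,c>0$ such that $F(x,p,l)\ge c|p|^{m'}-C(|l|+1)$ for all $x,p\in\mathbb{R}^N$, $l\in\mathbb{R}$. Let $u_0$ be bounded and uniformly continuous on $\mathbb{R}^N$. Let $\underline u$ be a bounded lower semicontinuous viscosity supersolution and $\bar u$ a bounded upper semicontinuous viscosity subsolution in $Q_T$ of the Cauchy problem $$u_t+F(x,Du,\mathcal{I}(u,x))=0\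 \text{ in }Q_T,\qquad u(x,0)=u_0(x),\ x\in\mathbb{R}^N,$$ both attaining uniformly continuously the initial data $u_0$, i.e. there is a modulus of continuity $\omega_0$ such that, for $u=\underline u$ and $u=\bar u$, $$\sup_{x\in\mathbb{R}^N}|u(x,t)-u_0(x)|\le\omega_0(t),\quad t\in[0,T].$$ Then $\bar u\le\underline u$ in $\bar Q_T$. In particular, there exists at most one viscosity solution of the Cauchy problem among functions that attain uniformly continuously the initial data $u_0$ (in the sense just described, for some modulus).
   Context: A modulus of continuity is a nondecreasing function $\omega:[0,\infty)\to[0,\infty)$ with $\omega(t)\to\omega(0)=0$ as $t\to0^+$. $B_\delta$ is the ball of radius $\delta$ centered at $0$, $B_\delta(x)$ the ball centered at $x$, $B=B_1$. Set $\mathbb{I}_\sigma=1$ if $\sigma=1$ and $\mathbb{I}_\sigma=0$ if $\sigma<1$. The nonlocal operator, acting in the space variable at fixed time, is $$\mathcal{I}(u,x)=\int_{\mathbb{R}^N}[u(x+z)-u(x)-\mathbb{I}_\sigma\mathbf 1_B(z)\langle Du(x),z\rangle]K^\sigma(z)\,dz .$$ Viscosity solutions. For $\delta\in(0,1)$, $\phi\in C^2$, bounded $u$ and $p\in\mathbb{R}^N$ set $\mathcal{I}[B_\delta](\phi,x)=\int_{B_\delta}[\phi(x+z,t)-\phi(x,t)-\mathbb{I}_\sigma\langle D\phi(x,t),z\rangle]K^\sigma(z)dz$ and $\mathcal{I}[B_\delta^c](u,p,x)=\int_{B_\delta^c}[u(x+z,t)-u(x,t)-\mathbb{I}_\sigma\mathbf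 1_B(z)\langle p,z\rangle]K^\sigma(z)dz$. A bounded upper semicontinuous (resp. lower semicontinuous) function $u$ on $\bar Q_T$ is a viscosity subsolution (resp. supersolution) of $u_t+F(x,Du,\mathcal{I}(u,x))=0$ in $Q_T$ if for every $(x,t)\in\mathbb{R}^N\times(0,T]$ and every $\phi\in C^2(\mathbb{R}^N\times(0,T])$ such that $(x,t)$ is a maximum (resp. minimum) point of $u-\phi$ in $B_\delta(x)\times(t-\delta,t+\delta)$ (intersected with $Q_T$) for a small $\delta>0$, one has $$\phi_t(x,t)+F\big(x,D\phi(x,t),\mathcal{I}[B_\delta](\phi,x)+\mathcal{I}[B_\delta^c](u,D\phi(x,t),x)\big)\le0\quad(\text{resp. }\ge0).$$ A bounded continuous function is a viscosity solution if it is both a sub- and a supersolution. *)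

theory Defs
  imports "HOL-Analysis.Analysis"
begin

definition modulus_of_continuity :: "(real \<Rightarrow> real) \<Rightarrow> bool" where
  "modulus_of_continuity \<omega> \<longleftrightarrow>
     (\<forall>t\<ge>0. 0 \<le> \<omega> t) \<and> mono_on {0..} \<omega> \<and> \<omega> 0 = 0 \<and> (\<omega> \<longlongrightarrow> 0) (at_right 0)"

definition usc_on :: "'a::topological_space set \<Rightarrow> ('a \<Rightarrow> real) \<Rightarrow> bool" where
  "usc_on S u \<longleftrightarrow> (\<forall>x\<in>S. \<forall>c>u x. \<forall>\<^sub>F y in at x within S. u y < c)"

definition lsc_on :: "'a::topological_space set \<Rightarrow> ('a \<Rightarrow> real) \<Rightarrow> bool" where
  "lsc_on S u \<longleftrightarrow> (\<forall>x\<in>S. \<forall>c<u x. \<forall>\<^sub>F y in at x within S. c < u y)"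

text \<open>Derivatives are taken within \<open>S\<close>. For \<open>S = \<real>\<^sup>N \<times> (0,T]\<close> they are uniquely determined; at the
  final time they are one-sided in time.\<close>

definition C2_on :: "'a::real_normed_vector set \<Rightarrow> ('a \<Rightarrow> real) \<Rightarrow> bool" where
  "C2_on S \<phi> \<longleftrightarrow>
     (\<exists>(D :: 'a \<Rightarrow> 'a \<Rightarrow>\<^sub>L real) (D2 :: 'a \<Rightarrow> 'a \<Rightarrow>\<^sub>L ('a \<Rightarrow>\<^sub>L real)).
        (\<forall>x\<in>S. (\<phi> has_derivative blinfun_apply (D x)) (at x within S)) \<and>
        (\<forall>x\<in>S. (D has_derivative blinfun_apply (D2 x)) (at x within S)) \<and>
        continuous_on S D2)"

definition grad :: "('a::real_inner \<Rightarrow> real) \<Rightarrow> 'a \<Rightarrow> 'a" where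
  "grad f x = (THE D. GDERIV f x :> D)"

definition parabolic_domain :: "real \<Rightarrow> ('a \<times> real) set" where
  "parabolic_domain T = UNIV \<times> {0<..T}"

definition closed_parabolic_domain :: "real \<Rightarrow> ('a \<times> real) set" where
  "closed_parabolic_domain T = UNIV \<times> {0..T}"

definition I_ind :: "real \<Rightarrow> real" where
  "I_ind \<sigma> = (if \<sigma> = 1 then 1 else 0)"

text \<open>The function arguments of the next two operators are space slices at a fixed time.\<close>

definition nonlocal_inner ::
    "real \<Rightarrow> ('a::euclidean_space \<Rightarrow> real) \<Rightarrow> real \<Rightarrow> ('a \<Rightarrow> real) \<Rightarrow> 'a \<Rightarrow> real" where
  "nonlocal_inner \<sigma> K \<delta> \<phi> x =
     (LINT z:ball 0 \<delta>|lebesgue. (\<phi> (x + z) - \<phi> x - I_ind \<sigma> * (grad \<phi> x \<bullet> z)) * K z)"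

definition nonlocal_outer ::
    "real \<Rightarrow> ('a::euclidean_space \<Rightarrow> real) \<Rightarrow> real \<Rightarrow> ('a \<Rightarrow> real) \<Rightarrow> 'a \<Rightarrow> 'a \<Rightarrow> real" where
  "nonlocal_outer \<sigma> K \<delta> u p x =
     (LINT z:- ball 0 \<delta>|lebesgue.
        (u (x + z) - u x - I_ind \<sigma> * indicator (ball 0 1) z * (p \<bullet> z)) * K z)"

text \<open>The left-hand side \<open>\<phi>\<^sub>t + F(x, D\<phi>, I[B\<^sub>\<delta>](\<phi>,x) + I[B\<^sub>\<delta>\<^sup>c](u,D\<phi>,x))\<close> of the viscosity
  inequalities at \<open>(x,t)\<close>.\<close>

definition visc_lhs ::
    "real \<Rightarrow> real \<Rightarrow> ('a::euclidean_space \<Rightarrow> real) \<Rightarrow> ('a \<Rightarrow> 'a \<Rightarrow> real \<Rightarrow> real) \<Rightarrow> real \<Rightarrow>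
     ('a \<times> real \<Rightarrow> real) \<Rightarrow> ('a \<times> real \<Rightarrow> real) \<Rightarrow> 'a \<Rightarrow> real \<Rightarrow> real" where
  "visc_lhs T \<sigma> K F \<delta> u \<phi> x t =
     (let p = grad (\<lambda>y. \<phi> (y, t)) x in
      vector_derivative (\<lambda>s. \<phi> (x, s)) (at t within {0<..T}) +
      F x p (nonlocal_inner \<sigma> K \<delta> (\<lambda>y. \<phi> (y, t)) x +
             nonlocal_outer \<sigma> K \<delta> (\<lambda>y. u (y, t)) p x))"

definition visc_subsolution ::
    "real \<Rightarrow> real \<Rightarrow> ('a::euclidean_space \<Rightarrow> real) \<Rightarrow> ('a \<Rightarrow> 'a \<Rightarrow> real \<Rightarrow> real) \<Rightarrow>
     ('a \<times> real \<Rightarrow> real) \<Rightarrow> bool" where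
  "visc_subsolution T \<sigma> K F u \<longleftrightarrow>
     bounded (u ` closed_parabolic_domain T) \<and> usc_on (closed_parabolic_domain T) u \<and>
     (\<forall>x t \<phi> \<delta>. (x, t) \<in> parabolic_domain T \<longrightarrow> C2_on (parabolic_domain T) \<phi> \<longrightarrow> 0 < \<delta> \<longrightarrow> \<delta> < 1 \<longrightarrow>
        (\<forall>(y, s) \<in> (ball x \<delta> \<times> {t - \<delta><..<t + \<delta>}) \<inter> parabolic_domain T.
           u (y, s) - \<phi> (y, s) \<le> u (x, t) - \<phi> (x, t)) \<longrightarrow>
        visc_lhs T \<sigma> K F \<delta> u \<phi> x t \<le> 0)"

definition visc_supersolution ::
    "real \<Rightarrow> real \<Rightarrow> ('a::euclidean_space \<Rightarrow> real) \<Rightarrow> ('a \<Rightarrow> 'a \<Rightarrow> real \<Rightarrow> real) \<Rightarrow>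
     ('a \<times> real \<Rightarrow> real) \<Rightarrow> bool" where
  "visc_supersolution T \<sigma> K F u \<longleftrightarrow>
     bounded (u ` closed_parabolic_domain T) \<and> lsc_on (closed_parabolic_domain T) u \<and>
     (\<forall>x t \<phi> \<delta>. (x, t) \<in> parabolic_domain T \<longrightarrow> C2_on (parabolic_domain T) \<phi> \<longrightarrow> 0 < \<delta> \<longrightarrow> \<delta> < 1 \<longrightarrow>
        (\<forall>(y, s) \<in> (ball x \<delta> \<times> {t - \<delta><..<t + \<delta>}) \<inter> parabolic_domain T.
           u (x, t) - \<phi> (x, t) \<le> u (y, s) - \<phi> (y, s)) \<longrightarrow>
        0 \<le> visc_lhs T \<sigma> K F \<delta> u \<phi> x t)"

definition visc_solution ::
    "real \<Rightarrow> real \<Rightarrow> ('a::euclidean_space \<Rightarrow> real) \<Rightarrow> ('a \<Rightarrow> 'a \<Rightarrow> real \<Rightarrow> real) \<Rightarrow>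
     ('a \<times> real \<Rightarrow> real) \<Rightarrow> bool" where
  "visc_solution T \<sigma> K F u \<longleftrightarrow>
     bounded (u ` closed_parabolic_domain T) \<and> continuous_on (closed_parabolic_domain T) u \<and>
     visc_subsolution T \<sigma> K F u \<and> visc_supersolution T \<sigma> K F u"

definition cauchy_visc_solution ::
    "real \<Rightarrow> real \<Rightarrow> ('a::euclidean_space \<Rightarrow> real) \<Rightarrow> ('a \<Rightarrow> 'a \<Rightarrow> real \<Rightarrow> real) \<Rightarrow>
     ('a \<Rightarrow> real) \<Rightarrow> ('a \<times> real \<Rightarrow> real) \<Rightarrow> bool" where
  "cauchy_visc_solution T \<sigma> K F u0 u \<longleftrightarrow>
     visc_solution T \<sigma> K F u \<and> (\<forall>x. u (x, 0) = u0 x)"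

definition attains_initial_with ::
    "real \<Rightarrow> ('a \<Rightarrow> real) \<Rightarrow> (real \<Rightarrow> real) \<Rightarrow> ('a \<times> real \<Rightarrow> real) \<Rightarrow> bool" where
  "attains_initial_with T u0 \<omega>0 u \<longleftrightarrow> (\<forall>t\<in>{0..T}. \<forall>x. \<bar>u (x, t) - u0 x\<bar> \<le> \<omega>0 t)"

end

theory Submission
  imports Defs
begin

text \<open>
  The sup-convolution in time \<open>sup\<^sub>\<tau> (u(x,\<tau>) - G (\<tau> - t)\<^sup>2)\<close> of a subsolution \<open>u\<close> satisfies, at every
  point touched from above by a space function, the stationary inequality with a bounded right-hand
  side, so coercivity bounds its gradient to the power \<open>m'\<close> by the size of the nonlocal term. If it
  is \<open>(1 - \<beta>)\<close>-Hoelder in space (\<open>\<beta> = 1\<close> is boundedness), that term is \<open>O(r\<^bsup>-\<beta>\<^esup>)\<close> at scale \<open>r\<close>, because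
  the order is at most one; sliding \<open>L |y - x|\<^bsup>1 - \<beta>/m'\<^esup>\<close> then shows that it is
  \<open>(1 - \<beta>/m')\<close>-Hoelder. Iterating, it is Hoelder with any exponent below one.

  Doubling the variables with \<open>|x - y|\<^sup>2/\<epsilon>\<^sup>2\<close>, the gradients and the nonlocal terms are therefore
  bounded by \<open>\<epsilon>\<^bsup>-C\<beta>\<^esup>\<close>, and since \<open>|x - y| = O(\<epsilon>)\<close> the argument of the modulus in the structure
  condition is \<open>O(\<epsilon>\<^bsup>1/2\<^esup>)\<close> once \<open>\<beta>\<close> is small, whatever \<open>m\<close> and \<open>n\<close>. By concavity of powers,
  paraboloids suffice as test functions.
\<close>

section \<open>Semicontinuous functions\<close>

lemma usc_on_iff_openin:
  "usc_on S u \<longleftrightarrow> (\<forall>c. openin (top_of_set S) {x \<in> S. u x < c})"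
proof
  assume usc: "usc_on S u"
  show "\<forall>c. openin (top_of_set S) {x \<in> S. u x < c}"
  proof (intro allI, subst openin_subopen, intro ballI)
    fix c x assume x: "x \<in> {x \<in> S. u x < c}"
    then have "\<forall>\<^sub>F y in at x within S. u y < c"
      using usc by (simp add: usc_on_def)
    then obtain V where "open V" "x \<in> V" "\<forall>y\<in>V. y \<noteq> x \<longrightarrow> y \<in> S \<longrightarrow> u y < c"
      unfolding eventually_at_topological by blast
    with x show "\<exists>W. openin (top_of_set S) W \<and> x \<in> W \<and> W \<subseteq> {x \<in> S. u x < c}"
      by (intro exI[of _ "S \<inter> V"]) auto
  qed
next
  assume opn: "\<forall>c. openin (top_of_set S) {x \<in> S. u x < c}"
  show "usc_on S u"
    unfolding usc_on_def eventually_at_topological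
  proof (intro ballI allI impI)
    fix x c assume x: "x \<in> S" "u x < c"
    obtain V where V: "open V" "{x \<in> S. u x < c} = S \<inter> V"
      using opn[rule_format, of c] unfolding openin_open by blast
    then have "\<forall>y\<in>V. y \<in> S \<longrightarrow> u y < c" "x \<in> V"
      using x by auto
    with V(1) show "\<exists>V. open V \<and> x \<in> V \<and> (\<forall>y\<in>V. y \<noteq> x \<longrightarrow> y \<in> S \<longrightarrow> u y < c)"
      by (intro exI[of _ V]) simp
  qed
qed

lemma usc_on_UNIV_iff_open: "usc_on UNIV u \<longleftrightarrow> (\<forall>c. open {x. u x < c})"
  by (simp add: usc_on_iff_openin)

lemma usc_on_uminus: "lsc_on S u \<Longrightarrow> usc_on S (\<lambda>x. - u x)"
  unfolding lsc_on_def usc_on_def minus_less_iff[of "u _"] by (simp add: minus_less_iff)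

lemma continuous_imp_usc_on: "continuous_on S f \<Longrightarrow> usc_on S f"
  unfolding usc_on_def continuous_on_def by (auto intro: order_tendstoD)

lemma usc_on_compose:
  assumes "usc_on S f" "continuous_on S' g" "g ` S' \<subseteq> S"
  shows "usc_on S' (\<lambda>x. f (g x))"
  unfolding usc_on_iff_openin
proof
  fix c
  have "openin (top_of_set S') (S' \<inter> g -` {y \<in> S. f y < c})"
    using assms by (intro continuous_openin_preimage[where T = S]) (auto simp: usc_on_iff_openin)
  also have "S' \<inter> g -` {y \<in> S. f y < c} = {x \<in> S'. f (g x) < c}"
    using assms(3) by auto
  finally show "openin (top_of_set S') {x \<in> S'. f (g x) < c}" .
qed

lemma usc_on_subset: "usc_on S f \<Longrightarrow> S' \<subseteq> S \<Longrightarrow> usc_on S' f"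
  using usc_on_compose[of S f S' "\<lambda>x. x"] by (simp add: continuous_on_id)

lemma usc_on_add:
  assumes "usc_on S f" "usc_on S g"
  shows "usc_on S (\<lambda>x. f x + g x)"
  unfolding usc_on_iff_openin
proof
  fix c
  have "f x + g x < c \<longleftrightarrow> (\<exists>d. f x < d \<and> g x < c - d)" for x
  proof
    assume "f x + g x < c"
    then obtain d where "f x < d" "d < c - g x"
      using dense[of "f x" "c - g x"] by (auto simp: less_diff_eq)
    then show "\<exists>d. f x < d \<and> g x < c - d"
      by (intro exI[of _ d]) simp
  qed (auto simp: less_diff_eq)
  then have "{x \<in> S. f x + g x < c} = (\<Union>d. {x \<in> S. f x < d} \<inter> {x \<in> S. g x < c - d})"
    by auto
  then show "openin (top_of_set S) {x \<in> S. f x + g x < c}"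
    using assms by (auto simp: usc_on_iff_openin intro!: openin_Union openin_Int)
qed

lemma usc_on_attains_sup:
  assumes "compact S" "S \<noteq> {}" "usc_on S f"
  shows "\<exists>x\<in>S. \<forall>y\<in>S. f y \<le> f x"
proof (rule ccontr)
  assume "\<not> ?thesis"
  then have "S \<subseteq> (\<Union>y\<in>S. {x \<in> S. f x < f y})"
    by (force simp: not_le)
  moreover have "openin (top_of_set S) {x \<in> S. f x < f y}" for y
    using assms(3) by (simp add: usc_on_iff_openin)
  ultimately obtain \<D> where \<D>: "\<D> \<subseteq> (\<lambda>y. {x \<in> S. f x < f y}) ` S" "finite \<D>" "S \<subseteq> \<Union>\<D>"
    using assms(1)[unfolded compact_eq_openin_cover, rule_format, of "(\<lambda>y. {x \<in> S. f x < f y}) ` S"]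
    by auto
  then obtain Y where Y: "Y \<subseteq> S" "finite Y" "\<D> = (\<lambda>y. {x \<in> S. f x < f y}) ` Y"
    by (meson finite_subset_image)
  then have cover: "\<exists>y\<in>Y. f x < f y" if "x \<in> S" for x
    using \<D>(3) that by blast
  then have "Max (f ` Y) \<in> f ` Y"
    using assms(2) Y(2) by (intro Max_in) auto
  then obtain y where y: "y \<in> Y" "Max (f ` Y) = f y"
    by blast
  then obtain y' where "y' \<in> Y" "f y < f y'"
    using cover Y(1) by blast
  then show False
    using Max_ge[of "f ` Y" "f y'"] Y(2) y(2) by simp
qed

lemma usc_on_UNIV_borel_measurable:
  fixes f :: "'a::topological_space \<Rightarrow> real"
  shows "usc_on UNIV f \<Longrightarrow> f \<in> borel_measurable borel"
  unfolding borel_measurable_iff_less by (simp add: usc_on_UNIV_iff_open)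

lemma usc_on_slice_attains_SUP:
  fixes f :: "'a::topological_space \<times> 'b::topological_space \<Rightarrow> real"
  assumes "compact C" "C \<noteq> {}" "usc_on (UNIV \<times> C) f"
  shows "\<exists>s\<in>C. (SUP s\<in>C. f (x, s)) = f (x, s) \<and> (\<forall>s'\<in>C. f (x, s') \<le> f (x, s))"
proof -
  have "usc_on C (\<lambda>s. f (x, s))"
    by (rule usc_on_compose[OF assms(3)]) (auto intro!: continuous_intros)
  then obtain s where s: "s \<in> C" "\<forall>s'\<in>C. f (x, s') \<le> f (x, s)"
    using usc_on_attains_sup[OF assms(1,2)] by blast
  then have "(SUP s\<in>C. f (x, s)) = f (x, s)"
    by (intro cSup_eq_maximum) auto
  with s show ?thesis by blast
qed

lemma usc_on_SUP_compact:
  fixes f :: "'a::topological_space \<times> 'b::topological_space \<Rightarrow> real"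
  assumes "compact C" "C \<noteq> {}" "usc_on (UNIV \<times> C) f"
  shows "usc_on UNIV (\<lambda>x. SUP s\<in>C. f (x, s))"
  unfolding usc_on_UNIV_iff_open
proof
  fix c
  have "closedin (top_of_set (UNIV \<times> C)) (UNIV \<times> C - {z \<in> UNIV \<times> C. f z < c})"
    using assms(3) by (intro closedin_diff) (auto simp: usc_on_iff_openin)
  moreover have "closed_map (prod_topology euclidean (top_of_set C)) (euclidean :: 'a topology) fst"
    using assms(1)
    by (intro Abstract_Topological_Spaces.closed_map_fst) (simp add: compact_space_subtopology)
  moreover have "prod_topology euclidean (top_of_set C) = top_of_set ((UNIV :: 'a set) \<times> C)"
    using subtopology_Times[of euclidean euclidean "UNIV :: 'a set" C]
    by simp
  ultimately have "closed (fst ` (UNIV \<times> C - {z \<in> UNIV \<times> C. f z < c}))"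
    unfolding closed_map_def by simp
  also have "fst ` (UNIV \<times> C - {z \<in> UNIV \<times> C. f z < c}) = {x. c \<le> (SUP s\<in>C. f (x, s))}"
  proof (intro set_eqI iffI)
    fix x assume x: "x \<in> {x. c \<le> (SUP s\<in>C. f (x, s))}"
    obtain s where "s \<in> C" "(SUP s\<in>C. f (x, s)) = f (x, s)"
      using usc_on_slice_attains_SUP[OF assms, of x] by blast
    with x show "x \<in> fst ` (UNIV \<times> C - {z \<in> UNIV \<times> C. f z < c})"
      by force
  next
    fix x assume "x \<in> fst ` (UNIV \<times> C - {z \<in> UNIV \<times> C. f z < c})"
    then obtain s where "s \<in> C" "c \<le> f (x, s)"
      by (force simp: not_less)
    then show "x \<in> {x. c \<le> (SUP s\<in>C. f (x, s))}"
      using usc_on_slice_attains_SUP[OF assms, of x] by force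
  qed
  finally show "open {x. (SUP s\<in>C. f (x, s)) < c}"
    by (simp add: closed_def Collect_neg_eq[symmetric] not_le)
qed

section \<open>Maxima on unbounded domains\<close>

lemma usc_minus_powr_attains_sup:
  fixes w :: "'a::euclidean_space \<Rightarrow> real"
  assumes usc: "usc_on UNIV w" and bound: "\<And>y. \<bar>w y\<bar> \<le> M"
    and L: "2 * M < L" and \<alpha>: "0 < \<alpha>"
  obtains y where "norm (y - x) < 1"
    "\<And>y'. w y' - L * norm (y' - x) powr \<alpha> \<le> w y - L * norm (y - x) powr \<alpha>"
proof -
  have "0 \<le> M" using bound[of x] by linarith
  then have L0: "0 < L" using L by linarith
  define f where "f y = w y + - (L * norm (y - x) powr \<alpha>)" for y
  have far: "f y < f x" if "1 \<le> norm (y - x)" for y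
  proof -
    have "L * 1 \<le> L * norm (y - x) powr \<alpha>"
      using that L0 \<alpha> by (intro mult_left_mono ge_one_powr_ge_zero) auto
    then show ?thesis
      using bound[of y] bound[of x] L by (simp add: f_def)
  qed
  have "usc_on (cball x 1) f"
    unfolding f_def using \<alpha>
    by (intro usc_on_add usc_on_subset[OF usc] continuous_imp_usc_on continuous_on_minus
        continuous_on_mult_left continuous_on_powr' continuous_intros) auto
  then obtain y where y: "y \<in> cball x 1" "\<forall>y'\<in>cball x 1. f y' \<le> f y"
    using usc_on_attains_sup[of "cball x 1" f] by auto
  then have "f x \<le> f y" by simp
  have "f y' \<le> f y" for y'
    using y far[of y'] \<open>f x \<le> f y\<close>
    by (cases "y' \<in> cball x 1") (fastforce simp: dist_norm norm_minus_commute)+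
  moreover have "norm (y - x) < 1"
    using far[of y] \<open>f x \<le> f y\<close> by force
  ultimately show ?thesis
    using that by (simp add: f_def)
qed

definition capped_sq_norm :: "'a::real_normed_vector \<Rightarrow> real" where
  "capped_sq_norm z = min 1 ((norm z)\<^sup>2)"

lemma capped_sq_norm_bounds:
  "0 \<le> capped_sq_norm z" "capped_sq_norm z \<le> 1" "capped_sq_norm z \<le> (norm z)\<^sup>2"
  by (simp_all add: capped_sq_norm_def)

lemma capped_sq_norm_inside: "norm z < 1 \<Longrightarrow> capped_sq_norm z = (norm z)\<^sup>2"
  by (simp add: capped_sq_norm_def power_le_one)

lemma capped_sq_norm_outside: "1 \<le> norm z \<Longrightarrow> capped_sq_norm z = 1"
  by (simp add: capped_sq_norm_def one_le_power)

text \<open>The penalty is centred at an almost maximal point, so it stays bounded and \<open>\<theta>\<close> is arbitrary.\<close>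

lemma usc_penalized_attains_sup:
  fixes f :: "'a::euclidean_space \<times> 'b::topological_space \<Rightarrow> real"
  assumes usc: "usc_on (UNIV \<times> Y) f" and bdd: "bdd_above (f ` (UNIV \<times> Y))" and \<theta>: "0 < \<theta>"
    and coercive: "\<And>x b. \<exists>C\<subseteq>Y. compact C \<and> (\<forall>x'\<in>cball x 1. \<forall>y\<in>Y - C. f (x', y) \<le> b)"
    and z0: "z0 \<in> UNIV \<times> Y"
  obtains x1 x y where "y \<in> Y" "norm (x - x1) < 1" "f z0 - \<theta> \<le> f (x, y)"
    "\<And>x' y'. y' \<in> Y \<Longrightarrow>
      f (x', y') - \<theta> * capped_sq_norm (x' - x1) \<le> f (x, y) - \<theta> * capped_sq_norm (x - x1)"
proof -
  let ?S = "Sup (f ` (UNIV \<times> Y))"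
  have upper: "f z \<le> ?S" if "z \<in> UNIV \<times> Y" for z
    using that bdd by (intro cSup_upper) auto
  obtain z1 where z1: "z1 \<in> UNIV \<times> Y" "?S - \<theta> < f z1"
    using less_cSupD[of "f ` (UNIV \<times> Y)" "?S - \<theta>"] z0 \<theta> by fastforce
  obtain x1 y1 where x1y1: "z1 = (x1, y1)" "y1 \<in> Y"
    using z1(1) by blast
  define g where "g z = f z + - (\<theta> * capped_sq_norm (fst z - x1))" for z
  obtain C where C: "C \<subseteq> Y" "compact C" "\<And>x y. x \<in> cball x1 1 \<Longrightarrow> y \<in> Y - C \<Longrightarrow> f (x, y) \<le> f z1"
    using coercive[of x1 "f z1"] by metis
  define E where "E = cball x1 1 \<times> insert y1 C"
  have "E \<subseteq> UNIV \<times> Y" using C(1) x1y1(2) by (auto simp: E_def)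
  then have "usc_on E g"
    unfolding g_def capped_sq_norm_def
    by (intro usc_on_add usc_on_subset[OF usc] continuous_imp_usc_on continuous_intros)
  moreover have "compact E" unfolding E_def using C(2) by (intro compact_Times) auto
  moreover have z1E: "z1 \<in> E" by (simp add: E_def x1y1(1))
  ultimately obtain z where z: "z \<in> E" "\<forall>z'\<in>E. g z' \<le> g z"
    using usc_on_attains_sup[of E g] by blast
  obtain x y where xy: "z = (x, y)" "y \<in> Y" using z(1) \<open>E \<subseteq> UNIV \<times> Y\<close> by blast
  have g_le: "g z' \<le> f z'" for z'
    using \<theta> capped_sq_norm_bounds(1)[of "fst z' - x1"] by (simp add: g_def)
  have z1_le: "f z1 \<le> g z" using z(2) z1E by (force simp: g_def x1y1(1) capped_sq_norm_def)
  have far: "g (x', y') < g z" if "1 \<le> norm (x' - x1)" "y' \<in> Y" for x' y'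
    using upper[of "(x', y')"] that z1(2) z1_le by (simp add: g_def capped_sq_norm_outside)
  have "g (x', y') \<le> g z" if "y' \<in> Y" for x' y'
  proof (cases "norm (x' - x1) < 1")
    case True
    then have "x' \<in> cball x1 1" by (simp add: dist_norm norm_minus_commute)
    then show ?thesis
      using z(2) C(3)[of x' y'] g_le[of "(x', y')"] z1_le that by (cases "y' \<in> C") (auto simp: E_def)
  qed (use far[of x' y'] that in simp)
  moreover have "norm (x - x1) < 1" using far[of x y] xy by force
  moreover have "f z0 - \<theta> \<le> f (x, y)"
    using upper[OF z0] z1(2) z1_le g_le[of z] by (simp add: xy(1))
  ultimately show ?thesis
    using that[of y x x1] xy by (simp add: g_def)
qed

section \<open>Moduli of continuity\<close>

lemma modulus_of_continuity_add:
  assumes "modulus_of_continuity \<omega>1" "modulus_of_continuity \<omega>2"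
  shows "modulus_of_continuity (\<lambda>t. \<omega>1 t + \<omega>2 t)"
proof -
  have "((\<lambda>t. \<omega>1 t + \<omega>2 t) \<longlongrightarrow> 0 + 0) (at_right 0)"
    using assms by (intro tendsto_add) (simp_all add: modulus_of_continuity_def)
  then show ?thesis
    using assms by (auto simp: modulus_of_continuity_def mono_on_def intro: add_mono)
qed

lemma modulus_of_continuity_small:
  assumes "modulus_of_continuity \<omega>" "0 < e"
  obtains r where "0 < r" "\<And>t. 0 \<le> t \<Longrightarrow> t < r \<Longrightarrow> \<omega> t < e"
proof -
  have "\<forall>\<^sub>F t in at_right 0. \<omega> t < e"
    using assms by (intro order_tendstoD(2)[of \<omega> 0]) (simp_all add: modulus_of_continuity_def)
  then obtain r where r: "0 < r" "\<And>t. 0 < t \<Longrightarrow> t < r \<Longrightarrow> \<omega> t < e"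
    unfolding eventually_at_right_field by auto
  have "\<omega> t < e" if "0 \<le> t" "t < r" for t
    using r(2)[of t] that assms by (cases "t = 0") (auto simp: modulus_of_continuity_def)
  then show ?thesis using that r(1) by blast
qed

lemma attains_initial_with_mono:
  assumes "attains_initial_with T u0 \<omega>1 u" "\<And>t. 0 \<le> t \<Longrightarrow> \<omega>1 t \<le> \<omega>2 t"
  shows "attains_initial_with T u0 \<omega>2 u"
  unfolding attains_initial_with_def
proof (intro ballI allI)
  fix t x assume "t \<in> {0..T}"
  then show "\<bar>u (x, t) - u0 x\<bar> \<le> \<omega>2 t"
    using assms(1)[unfolded attains_initial_with_def, rule_format, of t x] assms(2)[of t] by simp
qed

section \<open>Integrals of powers of the norm\<close>

lemma dyadic_scale:
  fixes r :: real
  assumes "0 < r"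
  obtains j :: int where "2 powr j \<le> r" "r < 2 * 2 powr j"
proof
  show "2 powr \<lfloor>log 2 r\<rfloor> \<le> r" "r < 2 * 2 powr \<lfloor>log 2 r\<rfloor>"
    using floor_log_eq_powr_iff[OF assms, of 2 "\<lfloor>log 2 r\<rfloor>"] by (simp_all add: powr_add mult.commute)
qed

lemma nn_integral_norm_powr_dyadic_annulus:
  fixes r q :: real
  assumes "0 < r"
  shows "(\<integral>\<^sup>+ z. indicator (ball 0 (2 * r) - ball 0 r) z * ennreal (norm z powr q)
      \<partial>(lborel :: 'a::euclidean_space measure))
    \<le> ennreal (max 1 (2 powr q) * unit_ball_vol DIM('a) * 2 ^ DIM('a) * r powr (q + DIM('a)))"
proof -
  have annulus_bound: "norm z powr q \<le> max 1 (2 powr q) * r powr q"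
    if "z \<in> ball 0 (2 * r) - ball 0 r" for z :: 'a
  proof (cases "0 \<le> q")
    case True
    then have "norm z powr q \<le> (2 * r) powr q"
      using that by (intro powr_mono2) auto
    also have "\<dots> \<le> max 1 (2 powr q) * r powr q"
      using assms by (simp add: powr_mult mult_right_mono)
    finally show ?thesis .
  next
    case False
    then have "norm z powr q \<le> 1 * r powr q"
      using that assms by (simp add: powr_mono2')
    also have "\<dots> \<le> max 1 (2 powr q) * r powr q"
      by (intro mult_right_mono) auto
    finally show ?thesis .
  qed
  have "(\<integral>\<^sup>+ z. indicator (ball (0::'a) (2 * r) - ball 0 r) z * ennreal (norm z powr q) \<partial>lborel)
      \<le> (\<integral>\<^sup>+ z. ennreal (max 1 (2 powr q) * r powr q) * indicator (ball (0::'a) (2 * r)) z \<partial>lborel)"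
    by (rule nn_integral_mono) (use annulus_bound in \<open>simp add: indicator_def ennreal_leI\<close>)
  also have "\<dots> = ennreal (max 1 (2 powr q) * r powr q * (unit_ball_vol DIM('a) * (2 * r) ^ DIM('a)))"
    using assms by (simp add: nn_integral_cmult_indicator emeasure_ball ennreal_mult)
  also have "max 1 (2 powr q) * r powr q * (unit_ball_vol DIM('a) * (2 * r) ^ DIM('a))
      = max 1 (2 powr q) * unit_ball_vol DIM('a) * 2 ^ DIM('a) * r powr (q + DIM('a))"
    using assms by (simp add: powr_add powr_realpow power_mult_distrib)
  finally show ?thesis .
qed

lemma nn_integral_norm_powr_dyadic:
  fixes r :: "nat \<Rightarrow> real" and q R \<rho> :: real
  assumes cover: "\<And>z. z \<in> S \<Longrightarrow> z \<noteq> 0 \<Longrightarrow> \<exists>k. z \<in> ball 0 (2 * r k) - ball 0 (r k)"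
    and r: "\<And>k. 0 < r k" "\<And>k. r k powr (q + DIM('a)) = R * \<rho> ^ k" and \<rho>: "0 < \<rho>" "\<rho> < 1"
  shows "(\<integral>\<^sup>+ z. indicator S z * ennreal (norm z powr q) \<partial>(lborel :: 'a::euclidean_space measure))
    \<le> ennreal (max 1 (2 powr q) * unit_ball_vol DIM('a) * 2 ^ DIM('a) / (1 - \<rho>) * R)"
proof -
  define A where "A k = (ball 0 (2 * r k) - ball 0 (r k) :: 'a set)" for k
  define D where "D = max 1 (2 powr q) * unit_ball_vol DIM('a) * 2 ^ DIM('a)"
  have "0 \<le> D" by (simp add: D_def)
  have "R \<ge> 0" using r(2)[of 0] powr_ge_zero[of "r 0" "q + DIM('a)"] by simp
  have indicator_le_suminf: "indicator S z * ennreal (norm z powr q)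
      \<le> (\<Sum>k. indicator (A k) z * ennreal (norm z powr q))" for z
  proof (cases "z \<in> S \<and> z \<noteq> 0")
    case True
    then obtain k where "z \<in> A k" using cover unfolding A_def by blast
    then have "indicator S z * ennreal (norm z powr q)
        \<le> sum (\<lambda>k. indicator (A k) z * ennreal (norm z powr q)) {k}"
      by (simp add: indicator_def)
    also have "\<dots> \<le> (\<Sum>k. indicator (A k) z * ennreal (norm z powr q))"
      by (rule sum_le_suminf) auto
    finally show ?thesis .
  qed (auto simp: indicator_def)
  have "(\<integral>\<^sup>+ z. indicator S z * ennreal (norm z powr q) \<partial>lborel)
      \<le> (\<integral>\<^sup>+ z. (\<Sum>k. indicator (A k) z * ennreal (norm z powr q)) \<partial>lborel)"
    by (intro nn_integral_mono indicator_le_suminf)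
  also have "\<dots> = (\<Sum>k. \<integral>\<^sup>+ z. indicator (A k) z * ennreal (norm z powr q) \<partial>lborel)"
    by (intro nn_integral_suminf)
      (auto simp: A_def intro!: borel_measurable_times_ennreal borel_measurable_indicator)
  also have "\<dots> \<le> (\<Sum>k. ennreal (D * (R * \<rho> ^ k)))"
    unfolding A_def D_def using nn_integral_norm_powr_dyadic_annulus[OF r(1), where 'a = 'a]
    by (intro suminf_le summableI) (simp flip: r(2))
  also have "\<dots> = ennreal (D * (R * (1 / (1 - \<rho>))))"
    using \<rho> \<open>0 \<le> D\<close> \<open>0 \<le> R\<close>
    by (intro suminf_ennreal_eq sums_mult geometric_sums) auto
  finally show ?thesis by (simp add: D_def)
qed

lemma integrable_lebesgue_of_nn_integral_lborel_le:
  fixes f :: "'a::euclidean_space \<Rightarrow> real"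
  assumes "f \<in> borel_measurable borel" "S \<in> sets borel" "\<And>z. 0 \<le> f z" "0 \<le> B"
    and bound: "(\<integral>\<^sup>+ z. indicator S z * ennreal (f z) \<partial>lborel) \<le> ennreal B"
  shows "set_integrable lebesgue S f" "(LINT z:S|lebesgue. f z) \<le> B"
proof -
  have nn_integral_eq: "(\<integral>\<^sup>+ z. ennreal (indicator S z * f z) \<partial>lebesgue)
      = (\<integral>\<^sup>+ z. indicator S z * ennreal (f z) \<partial>lborel)"
    using assms(3) by (simp add: nn_integral_completion ennreal_mult' ennreal_indicator)
  have "(\<lambda>z. indicator S z * f z) \<in> borel_measurable lebesgue"
    using assms(1,2) by (intro measurable_completion) simp
  then show "set_integrable lebesgue S f"
    unfolding set_integrable_def real_scaleR_def using bound assms(3)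
    by (intro integrableI_nonneg) (auto simp: nn_integral_eq intro: le_less_trans)
  show "(LINT z:S|lebesgue. f z) \<le> B"
    unfolding set_lebesgue_integral_def real_scaleR_def
    using bound assms(4) by (intro integral_real_bounded) (simp_all add: nn_integral_eq)
qed

lemma integral_norm_powr_dyadic:
  fixes q t :: real and S :: "real \<Rightarrow> 'a::euclidean_space set"
  assumes t: "0 < t" "t powr (q + DIM('a)) < 1" and S: "\<And>\<delta>. S \<delta> \<in> sets borel"
    and cover: "\<And>\<delta> z. 0 < \<delta> \<Longrightarrow> z \<in> S \<delta> \<Longrightarrow> z \<noteq> 0 \<Longrightarrow> \<exists>k. z \<in> ball 0 (2 * (t ^ k * \<delta>)) - ball 0 (t ^ k * \<delta>)"
  shows "\<exists>A\<ge>0. \<forall>\<delta>>0. set_integrable lebesgue (S \<delta>) (\<lambda>z. norm z powr q) \<and>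
    (LINT z:S \<delta>|lebesgue. norm z powr q) \<le> A * \<delta> powr (q + DIM('a))"
proof -
  define \<rho> where "\<rho> = t powr (q + DIM('a))"
  define A where "A = max 1 (2 powr q) * unit_ball_vol DIM('a) * 2 ^ DIM('a) / (1 - \<rho>)"
  have \<rho>: "0 < \<rho>" "\<rho> < 1" using t by (simp_all add: \<rho>_def)
  then have A: "0 \<le> A" by (simp add: A_def)
  have bound: "(\<integral>\<^sup>+ z. indicator (S \<delta>) z * ennreal (norm z powr q) \<partial>lborel)
      \<le> ennreal (A * \<delta> powr (q + DIM('a)))" if \<delta>: "0 < \<delta>" for \<delta>
    unfolding A_def
  proof (rule nn_integral_norm_powr_dyadic[where r = "\<lambda>k. t ^ k * \<delta>", OF cover[OF \<delta>]])
    show "(t ^ k * \<delta>) powr (q + DIM('a)) = \<delta> powr (q + DIM('a)) * \<rho> ^ k" for k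
      using t(1) \<delta> by (simp add: \<rho>_def powr_mult powr_powr mult.commute flip: powr_realpow)
  qed (use \<delta> \<rho> t(1) in auto)
  show ?thesis
    using A S
    by (intro exI[of _ A] conjI allI impI
        integrable_lebesgue_of_nn_integral_lborel_le[OF _ _ _ _ bound]) auto
qed

lemma integral_norm_powr_outside_ball:
  fixes q :: real
  assumes "q + DIM('a) < 0"
  shows "\<exists>A\<ge>0. \<forall>\<delta>>0. set_integrable lebesgue (- ball (0::'a::euclidean_space) \<delta>) (\<lambda>z. norm z powr q) \<and>
    (LINT z:- ball (0::'a) \<delta>|lebesgue. norm z powr q) \<le> A * \<delta> powr (q + DIM('a))"
proof (rule integral_norm_powr_dyadic[where t = 2])
  show "2 powr (q + DIM('a)) < 1" using assms by (simp add: powr_less_one)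
  fix \<delta> :: real and z :: 'a
  assume \<delta>: "0 < \<delta>" and z: "z \<in> - ball 0 \<delta>" "z \<noteq> 0"
  obtain j :: int where j: "2 powr j \<le> norm z / \<delta>" "norm z / \<delta> < 2 * 2 powr j"
    using dyadic_scale[of "norm z / \<delta>"] \<delta> z(2) by auto
  have "1 \<le> norm z / \<delta>" using z \<delta> by simp
  then have "2 powr 0 < 2 powr (real_of_int (j + 1))" using j by (simp add: powr_add)
  then have "0 \<le> j" by (simp only: powr_less_cancel_iff)
  then have "(2::real) powr j = 2 ^ nat j" by (simp add: powr_int)
  with j \<delta> show "\<exists>k. z \<in> ball 0 (2 * (2 ^ k * \<delta>)) - ball 0 (2 ^ k * \<delta>)"
    by (intro exI[of _ "nat j"]) (simp add: field_simps)
qed auto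

lemma integral_norm_powr_inside_ball:
  fixes q :: real
  assumes "0 < q + DIM('a)"
  shows "\<exists>A\<ge>0. \<forall>\<delta>>0. set_integrable lebesgue (ball (0::'a::euclidean_space) \<delta>) (\<lambda>z. norm z powr q) \<and>
    (LINT z:ball (0::'a) \<delta>|lebesgue. norm z powr q) \<le> A * \<delta> powr (q + DIM('a))"
proof (rule integral_norm_powr_dyadic[where t = "1 / 2"])
  show "(1 / 2) powr (q + DIM('a)) < 1"
    using assms powr_less_mono2[of "q + DIM('a)" "1 / 2" 1] by simp
  fix \<delta> :: real and z :: 'a
  assume \<delta>: "0 < \<delta>" and z: "z \<in> ball 0 \<delta>" "z \<noteq> 0"
  obtain j :: int where j: "2 powr j \<le> norm z / \<delta>" "norm z / \<delta> < 2 * 2 powr j"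
    using dyadic_scale[of "norm z / \<delta>"] \<delta> z(2) by auto
  have "norm z / \<delta> < 1" using z \<delta> by simp
  then have "2 powr real_of_int j < 2 powr 0" using j by simp
  then have "j \<le> 0" by (simp only: powr_less_cancel_iff)
  then have "(2::real) powr j = (1 / 2) ^ nat (- j)"
    by (simp add: powr_int power_one_over)
  with j \<delta> show "\<exists>k. z \<in> ball 0 (2 * ((1 / 2) ^ k * \<delta>)) - ball 0 ((1 / 2) ^ k * \<delta>)"
    by (intro exI[of _ "nat (- j)"]) (simp add: field_simps)
qed auto

section \<open>Kernels of order at most one\<close>

lemma set_integral_dominated:
  fixes f g :: "'a \<Rightarrow> real"
  assumes "set_integrable M S g" "f \<in> borel_measurable M" "S \<in> sets M"
    and dominated: "\<And>z. z \<in> S \<Longrightarrow> \<bar>f z\<bar> \<le> g z"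
  shows "set_integrable M S f" "\<bar>LINT z:S|M. f z\<bar> \<le> (LINT z:S|M. g z)"
proof -
  show f: "set_integrable M S f"
  proof (rule set_integrable_bound[OF assms(1)])
    show "set_borel_measurable M S f"
      unfolding set_borel_measurable_def
      by (intro borel_measurable_scaleR borel_measurable_indicator assms)
  qed (use dominated in force)
  have "(LINT z:S|M. f z) \<le> (LINT z:S|M. g z)"
    using dominated by (intro set_integral_mono f assms(1)) force
  moreover have "(LINT z:S|M. - g z) \<le> (LINT z:S|M. f z)"
  proof (intro set_integral_mono f)
    show "set_integrable M S (\<lambda>z. - g z)"
      using set_integrable_mult_right[OF assms(1), of "-1"] by simp
  qed (use dominated in force)
  ultimately show "\<bar>LINT z:S|M. f z\<bar> \<le> (LINT z:S|M. g z)"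
    by (simp add: set_integral_uminus[OF assms(1)])
qed

lemma borel_measurable_norm_powr:
  "(\<lambda>z::'a::euclidean_space. norm z powr q) \<in> borel_measurable lebesgue"
  by (intro measurable_completion) measurable

lemma borel_measurable_inner_left:
  "(\<lambda>z::'a::euclidean_space. p \<bullet> z) \<in> borel_measurable lebesgue"
  by (intro measurable_completion) measurable

locale small_order_kernel =
  fixes \<sigma> :: real and K :: "'a::euclidean_space \<Rightarrow> real" and Kb :: real
  assumes order_pos: "0 < \<sigma>" and order_le_one: "\<sigma> \<le> 1"
    and K_nonneg: "\<And>z. 0 \<le> K z"
    and K_measurable: "K \<in> borel_measurable lebesgue"
    and K_le: "\<And>z. z \<noteq> 0 \<Longrightarrow> K z \<le> Kb * norm z powr - (real DIM('a) + \<sigma>)"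
begin

lemma Kb_nonneg: "0 \<le> Kb"
proof -
  obtain z :: 'a where z: "norm z = 1" using vector_choose_size[of 1] by auto
  then have "z \<noteq> 0" by auto
  then show ?thesis using K_nonneg[of z] K_le[of z] z by simp
qed

definition kernel_moment :: "'a set \<Rightarrow> real \<Rightarrow> real" where
  "kernel_moment S q = (LINT z:S|lebesgue. norm z powr q * K z)"

definition kernel_tail :: "real \<Rightarrow> real" where
  "kernel_tail \<delta> = (LINT z:- ball 0 \<delta>|lebesgue. K z)"

lemma kernel_moment_nonneg: "0 \<le> kernel_moment S q"
  unfolding kernel_moment_def set_lebesgue_integral_def
  using K_nonneg by (intro Bochner_Integration.integral_nonneg) simp

lemma kernel_tail_nonneg: "0 \<le> kernel_tail \<delta>"
  unfolding kernel_tail_def set_lebesgue_integral_def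
  using K_nonneg by (intro Bochner_Integration.integral_nonneg) simp

lemma kernel_moment_le_power_integral:
  fixes q :: real
  assumes "set_integrable lebesgue S (\<lambda>z. norm z powr (q - DIM('a) - \<sigma>))" "S \<in> sets lebesgue"
  shows "set_integrable lebesgue S (\<lambda>z. norm z powr q * K z)"
    and "(LINT z:S|lebesgue. norm z powr (q - DIM('a) - \<sigma>)) \<le> B \<Longrightarrow> kernel_moment S q \<le> Kb * B"
proof -
  have integrand_le: "\<bar>norm z powr q * K z\<bar> \<le> Kb * norm z powr (q - DIM('a) - \<sigma>)" for z
  proof (cases "z = 0")
    case False
    then have "norm z powr q * K z \<le> norm z powr q * (Kb * norm z powr - (real DIM('a) + \<sigma>))"
      using K_le by (intro mult_left_mono) auto
    also have "\<dots> = Kb * norm z powr (q + - (real DIM('a) + \<sigma>))"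
      by (simp add: powr_add)
    finally show ?thesis using K_nonneg by (simp add: algebra_simps)
  qed simp
  note moment_dominated = set_integral_dominated[OF set_integrable_mult_right[OF assms(1)]
      _ assms(2) integrand_le, OF borel_measurable_times[OF borel_measurable_norm_powr K_measurable]]
  show "set_integrable lebesgue S (\<lambda>z. norm z powr q * K z)"
    by (rule moment_dominated)
  show "kernel_moment S q \<le> Kb * B" if "(LINT z:S|lebesgue. norm z powr (q - DIM('a) - \<sigma>)) \<le> B"
    using moment_dominated(2) mult_left_mono[OF that Kb_nonneg] by (simp add: kernel_moment_def)
qed

lemma kernel_moment_inside_ball:
  assumes "\<sigma> < q"
  obtains A where "0 \<le> A"
    "\<And>\<delta>. 0 < \<delta> \<Longrightarrow> set_integrable lebesgue (ball 0 \<delta>) (\<lambda>z. norm z powr q * K z)"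
    "\<And>\<delta>. 0 < \<delta> \<Longrightarrow> kernel_moment (ball 0 \<delta>) q \<le> A * \<delta> powr (q - \<sigma>)"
proof -
  obtain A where A: "0 \<le> A"
    "\<forall>\<delta>>0. set_integrable lebesgue (ball (0::'a) \<delta>) (\<lambda>z. norm z powr (q - DIM('a) - \<sigma>))
      \<and> (LINT z:ball (0::'a) \<delta>|lebesgue. norm z powr (q - DIM('a) - \<sigma>)) \<le> A * \<delta> powr (q - \<sigma>)"
    using integral_norm_powr_inside_ball[of "q - DIM('a) - \<sigma>", where 'a = 'a] assms by auto
  have "kernel_moment (ball 0 \<delta>) q \<le> Kb * A * \<delta> powr (q - \<sigma>)" if "0 < \<delta>" for \<delta>
    using kernel_moment_le_power_integral(2)[of "ball 0 \<delta>" q "A * \<delta> powr (q - \<sigma>)"] A(2) that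
    by (simp add: mult.assoc)
  then show ?thesis
    using A Kb_nonneg kernel_moment_le_power_integral(1) by (intro that[of "Kb * A"]) auto
qed

lemma kernel_moment_outside_ball:
  assumes "0 < b"
  obtains A where "0 \<le> A"
    "\<And>\<delta>. 0 < \<delta> \<Longrightarrow> set_integrable lebesgue (- ball 0 \<delta>) (\<lambda>z. norm z powr (\<sigma> - b) * K z)"
    "\<And>\<delta>. 0 < \<delta> \<Longrightarrow> kernel_moment (- ball 0 \<delta>) (\<sigma> - b) \<le> A * \<delta> powr - b"
proof -
  obtain A where A: "0 \<le> A"
    "\<forall>\<delta>>0. set_integrable lebesgue (- ball (0::'a) \<delta>) (\<lambda>z. norm z powr (\<sigma> - b - DIM('a) - \<sigma>))
      \<and> (LINT z:- ball (0::'a) \<delta>|lebesgue. norm z powr (\<sigma> - b - DIM('a) - \<sigma>)) \<le> A * \<delta> powr - b"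
    using integral_norm_powr_outside_ball[of "\<sigma> - b - DIM('a) - \<sigma>", where 'a = 'a] assms by auto
  have "kernel_moment (- ball 0 \<delta>) (\<sigma> - b) \<le> Kb * A * \<delta> powr - b" if "0 < \<delta>" for \<delta>
    using kernel_moment_le_power_integral(2)[of "- ball 0 \<delta>" "\<sigma> - b" "A * \<delta> powr - b"] A(2) that
    by (simp add: mult.assoc)
  then show ?thesis
    using A Kb_nonneg kernel_moment_le_power_integral(1) by (intro that[of "Kb * A"]) auto
qed

lemma kernel_integrable_outside_ball:
  assumes "0 < \<delta>"
  shows "set_integrable lebesgue (- ball 0 \<delta>) K"
proof -
  have "set_integrable lebesgue (- ball 0 \<delta>) (\<lambda>z. norm z powr (\<sigma> - \<sigma>) * K z)"
    using kernel_moment_outside_ball[OF order_pos] assms by blast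
  then show ?thesis
    using assms by (subst set_integrable_cong[OF refl refl]) auto
qed

lemma kernel_second_moment_le:
  obtains A where "0 \<le> A"
    "\<And>\<delta>. 0 < \<delta> \<Longrightarrow> \<delta> \<le> 1 \<Longrightarrow> kernel_moment (ball 0 \<delta>) 2 \<le> A * \<delta>"
proof -
  have "\<sigma> < 2" using order_le_one by simp
  from kernel_moment_inside_ball[OF this]
  obtain A where A: "0 \<le> A" "\<And>\<delta>. 0 < \<delta> \<Longrightarrow> kernel_moment (ball 0 \<delta>) 2 \<le> A * \<delta> powr (2 - \<sigma>)"
    by metis
  have "A * \<delta> powr (2 - \<sigma>) \<le> A * \<delta>" if "0 < \<delta>" "\<delta> \<le> 1" for \<delta>
  proof -
    have "\<delta> powr (2 - \<sigma>) \<le> \<delta> powr 1"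
      using that order_le_one by (intro powr_mono') auto
    then show ?thesis using A that by (intro mult_left_mono) auto
  qed
  with A show ?thesis by (intro that[of A]) (auto intro: order_trans)
qed

text \<open>For \<open>\<sigma> < 1\<close> the gradient is not subtracted in the operator, so it contributes a first moment.\<close>

definition drift :: "real \<Rightarrow> 'a \<Rightarrow> real" where
  "drift \<delta> p = (LINT z:ball 0 \<delta>|lebesgue. (1 - I_ind \<sigma>) * (p \<bullet> z) * K z)"

lemma drift_dominated:
  obtains A where "0 \<le> A"
    "\<And>\<delta> p. 0 < \<delta> \<Longrightarrow> set_integrable lebesgue (ball 0 \<delta>) (\<lambda>z. (1 - I_ind \<sigma>) * (p \<bullet> z) * K z)"
    "\<And>\<delta> p. 0 < \<delta> \<Longrightarrow> \<delta> \<le> 1 \<Longrightarrow> \<bar>drift \<delta> p\<bar> \<le> A * norm p"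
proof (cases "\<sigma> = 1")
  case True
  then have "I_ind \<sigma> = 1" by (simp add: I_ind_def)
  then show ?thesis
    by (intro that[of 0]) (simp_all add: drift_def set_integrable_def)
next
  case False
  then have "\<sigma> < 1" and I0: "I_ind \<sigma> = 0" using order_le_one by (simp_all add: I_ind_def)
  obtain A where A: "0 \<le> A"
    "\<And>\<delta>. 0 < \<delta> \<Longrightarrow> set_integrable lebesgue (ball 0 \<delta>) (\<lambda>z. norm z powr 1 * K z)"
    "\<And>\<delta>. 0 < \<delta> \<Longrightarrow> kernel_moment (ball 0 \<delta>) 1 \<le> A * \<delta> powr (1 - \<sigma>)"
    using kernel_moment_inside_ball[OF \<open>\<sigma> < 1\<close>] by blast
  have integrand_le: "\<bar>(1 - I_ind \<sigma>) * (p \<bullet> z) * K z\<bar> \<le> norm p * (norm z powr 1 * K z)" for p z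
    using mult_right_mono[OF Cauchy_Schwarz_ineq2[of p z] K_nonneg[of z]] K_nonneg[of z]
    by (simp add: I0 abs_mult mult.assoc)
  have "(\<lambda>z. (1 - I_ind \<sigma>) * (p \<bullet> z) * K z) \<in> borel_measurable lebesgue" for p
    by (intro borel_measurable_times borel_measurable_inner_left K_measurable) simp
  note drift_le = set_integral_dominated[OF set_integrable_mult_right[OF A(2)] this _ integrand_le]
  show ?thesis
  proof (rule that[OF A(1)])
    show "set_integrable lebesgue (ball 0 \<delta>) (\<lambda>z. (1 - I_ind \<sigma>) * (p \<bullet> z) * K z)" if "0 < \<delta>" for \<delta> p
      using that by (intro drift_le) auto
    show "\<bar>drift \<delta> p\<bar> \<le> A * norm p" if \<delta>: "0 < \<delta>" "\<delta> \<le> 1" for \<delta> p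
    proof -
      have "\<bar>drift \<delta> p\<bar> \<le> norm p * kernel_moment (ball 0 \<delta>) 1"
        using drift_le(2)[OF \<delta>(1)] by (simp add: drift_def kernel_moment_def)
      also have "\<dots> \<le> norm p * (A * \<delta> powr (1 - \<sigma>))"
        using A(3) \<delta> by (intro mult_left_mono) auto
      also have "\<dots> \<le> norm p * (A * 1)"
        using A(1) \<delta> order_le_one by (intro mult_left_mono powr_le1) auto
      finally show ?thesis by (simp add: mult.commute)
    qed
  qed
qed

lemma drift_integrable:
  assumes "0 < \<delta>"
  shows "set_integrable lebesgue (ball 0 \<delta>) (\<lambda>z. (1 - I_ind \<sigma>) * (p \<bullet> z) * K z)"
  by (rule drift_dominated) (use assms in blast)

lemma drift_diff: "0 < \<delta> \<Longrightarrow> drift \<delta> (p - q) = drift \<delta> p - drift \<delta> q"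
  unfolding drift_def inner_diff_left
  using set_integral_diff(2)[OF drift_integrable[of \<delta> p] drift_integrable[of \<delta> q]]
  by (simp add: right_diff_distrib left_diff_distrib)

lemma drift_zero: "drift \<delta> 0 = 0"
  by (simp add: drift_def)

lemma abs_compensator_le:
  assumes "q \<le> 1"
  shows "\<bar>I_ind \<sigma> * indicator (ball 0 1) z * (p \<bullet> z)\<bar> \<le> norm p * norm z powr q"
proof (cases "z \<noteq> 0 \<and> norm z < 1")
  case True
  then have "norm z powr 1 \<le> norm z powr q"
    using assms by (intro powr_mono') auto
  then have "norm p * norm z \<le> norm p * norm z powr q"
    by (intro mult_left_mono) auto
  with Cauchy_Schwarz_ineq2[of p z] have "\<bar>p \<bullet> z\<bar> \<le> norm p * norm z powr q"
    by linarith
  then show ?thesis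
    using True by (simp add: I_ind_def)
qed auto

definition outer_increment :: "('a \<Rightarrow> real) \<Rightarrow> 'a \<Rightarrow> 'a \<Rightarrow> 'a \<Rightarrow> real" where
  "outer_increment w p x z = w (x + z) - w x - I_ind \<sigma> * indicator (ball 0 1) z * (p \<bullet> z)"

lemma nonlocal_outer_eq:
  "nonlocal_outer \<sigma> K \<delta> w p x = (LINT z:- ball 0 \<delta>|lebesgue. outer_increment w p x z * K z)"
  by (simp add: nonlocal_outer_def outer_increment_def)

lemma outer_increment_measurable:
  assumes "w \<in> borel_measurable borel"
  shows "(\<lambda>z. outer_increment w p x z * K z) \<in> borel_measurable lebesgue"
proof -
  have "(\<lambda>z. outer_increment w p x z) \<in> borel_measurable borel"
    unfolding outer_increment_def
    by (intro borel_measurable_diff borel_measurable_times measurable_compose[OF _ assms]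
        borel_measurable_indicator) auto
  then have "(\<lambda>z. outer_increment w p x z) \<in> borel_measurable lebesgue"
    by (intro measurable_completion) simp
  then show ?thesis
    by (intro borel_measurable_times K_measurable)
qed

lemma outer_increment_integrable:
  assumes "w \<in> borel_measurable borel" "\<And>y. \<bar>w y\<bar> \<le> M" "0 < \<delta>"
  shows "set_integrable lebesgue (- ball 0 \<delta>) (\<lambda>z. outer_increment w p x z * K z)"
proof (rule set_integral_dominated(1))
  show "set_integrable lebesgue (- ball 0 \<delta>) (\<lambda>z. (2 * M + norm p) * K z)"
    by (intro set_integrable_mult_right kernel_integrable_outside_ball assms)
  fix z :: 'a
  have "norm p * norm z powr 0 \<le> norm p" by simp
  then have "\<bar>outer_increment w p x z\<bar> \<le> 2 * M + norm p"
    using abs_compensator_le[of 0 z p] assms(2)[of x] assms(2)[of "x + z"]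
    unfolding outer_increment_def by linarith
  then show "\<bar>outer_increment w p x z * K z\<bar> \<le> (2 * M + norm p) * K z"
    using K_nonneg[of z] by (simp add: abs_mult mult_right_mono)
qed (use assms(1) in \<open>simp_all add: outer_increment_measurable\<close>)

lemma nonlocal_outer_mono:
  assumes "w1 \<in> borel_measurable borel" "\<And>y. \<bar>w1 y\<bar> \<le> B1"
    and "w2 \<in> borel_measurable borel" "\<And>y. \<bar>w2 y\<bar> \<le> B2" "0 < \<delta>"
    and increment_le: "\<And>z. outer_increment w1 p1 x1 z \<le> outer_increment w2 p2 x2 z + E"
  shows "nonlocal_outer \<sigma> K \<delta> w1 p1 x1 \<le> nonlocal_outer \<sigma> K \<delta> w2 p2 x2 + E * kernel_tail \<delta>"
proof -
  have int1: "set_integrable lebesgue (- ball 0 \<delta>) (\<lambda>z. outer_increment w1 p1 x1 z * K z)"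
    and int2: "set_integrable lebesgue (- ball 0 \<delta>) (\<lambda>z. outer_increment w2 p2 x2 z * K z)"
    and int_E: "set_integrable lebesgue (- ball 0 \<delta>) (\<lambda>z. E * K z)"
    using assms
    by (auto intro!: outer_increment_integrable set_integrable_mult_right kernel_integrable_outside_ball)
  have "nonlocal_outer \<sigma> K \<delta> w1 p1 x1
      \<le> (LINT z:- ball 0 \<delta>|lebesgue. outer_increment w2 p2 x2 z * K z + E * K z)"
    unfolding nonlocal_outer_eq using mult_right_mono[OF increment_le K_nonneg]
    by (intro set_integral_mono int1 set_integral_add(1) int2 int_E) (simp add: distrib_right)
  also have "\<dots> = nonlocal_outer \<sigma> K \<delta> w2 p2 x2 + E * kernel_tail \<delta>"
    unfolding nonlocal_outer_eq kernel_tail_def using set_integral_add(2)[OF int2 int_E] by simp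
  finally show ?thesis .
qed

lemma outer_increment_le_powr:
  assumes bound: "\<And>y. \<bar>w y\<bar> \<le> M" and "0 \<le> A" "0 < b"
    and holder: "\<And>z. \<bar>w (x + z) - w x\<bar> \<le> A * norm z powr (1 - \<beta>)"
  shows "\<bar>outer_increment w p x z\<bar>
    \<le> A * norm z powr (\<sigma> - \<beta>) + 2 * M * indicator (- ball 0 1) z + norm p * norm z powr (\<sigma> - b)"
proof -
  have "\<bar>w (x + z) - w x\<bar> \<le> A * norm z powr (\<sigma> - \<beta>) + 2 * M * indicator (- ball 0 1) z"
  proof (cases "norm z < 1")
    case True
    then have "norm z powr (1 - \<beta>) \<le> norm z powr (\<sigma> - \<beta>)"
      using order_le_one by (cases "z = 0") (auto intro: powr_mono')
    then have "A * norm z powr (1 - \<beta>) \<le> A * norm z powr (\<sigma> - \<beta>)"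
      by (rule mult_left_mono) fact
    then show ?thesis using holder[of z] True by simp
  next
    case False
    moreover have "0 \<le> A * norm z powr (\<sigma> - \<beta>)" using \<open>0 \<le> A\<close> by simp
    ultimately show ?thesis using bound[of x] bound[of "x + z"] by simp
  qed
  moreover have "\<bar>I_ind \<sigma> * indicator (ball 0 1) z * (p \<bullet> z)\<bar> \<le> norm p * norm z powr (\<sigma> - b)"
    using order_le_one \<open>0 < b\<close> by (intro abs_compensator_le) simp
  ultimately show ?thesis
    unfolding outer_increment_def by linarith
qed

lemma abs_nonlocal_outer_le:
  assumes w: "w \<in> borel_measurable borel" "\<And>y. \<bar>w y\<bar> \<le> M" and \<delta>: "0 < \<delta>" "\<delta> < 1"
    and holder: "\<And>z. \<bar>w (x + z) - w x\<bar> \<le> A * norm z powr (1 - \<beta>)"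
    and pos: "0 \<le> A" "0 < \<beta>" "0 < b"
  shows "\<bar>nonlocal_outer \<sigma> K \<delta> w p x\<bar> \<le> A * kernel_moment (- ball 0 \<delta>) (\<sigma> - \<beta>)
    + 2 * M * kernel_tail 1 + norm p * kernel_moment (- ball 0 \<delta>) (\<sigma> - b)"
proof -
  have moment: "set_integrable lebesgue (- ball 0 \<delta>) (\<lambda>z. norm z powr (\<sigma> - q) * K z)" if "0 < q" for q
    using kernel_moment_outside_ball[OF that] \<delta>(1) by blast
  have "- ball 0 1 \<subseteq> - ball (0::'a) \<delta>" using \<delta> by auto
  then have absorb:
    "indicator (- ball 0 \<delta>) z * (indicator (- ball 0 1) z * y) = indicator (- ball 0 1) z * y"
    for z :: 'a and y :: real
    by (auto simp: indicator_def)
  have tail: "set_integrable lebesgue (- ball 0 \<delta>) (\<lambda>z. indicator (- ball 0 1) z * K z)"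
    using kernel_integrable_outside_ball[of 1] by (simp add: set_integrable_def absorb)
  note integrable = set_integrable_mult_right[OF moment[OF pos(2)], of A]
    set_integrable_mult_right[OF tail, of "2 * M"]
    set_integrable_mult_right[OF moment[OF pos(3)], of "norm p"]
  note integrable_sum = set_integral_add(1)[OF integrable(1,2)]
  have "\<bar>outer_increment w p x z * K z\<bar> \<le> A * (norm z powr (\<sigma> - \<beta>) * K z)
      + 2 * M * (indicator (- ball 0 1) z * K z) + norm p * (norm z powr (\<sigma> - b) * K z)" for z
    using mult_right_mono[OF outer_increment_le_powr[OF w(2) pos(1,3) holder, of p z] K_nonneg[of z]]
      K_nonneg[of z]
    by (simp only: abs_mult abs_of_nonneg distrib_right mult.assoc)
  then have "\<bar>nonlocal_outer \<sigma> K \<delta> w p x\<bar>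
    \<le> (LINT z:- ball 0 \<delta>|lebesgue. A * (norm z powr (\<sigma> - \<beta>) * K z)
      + 2 * M * (indicator (- ball 0 1) z * K z) + norm p * (norm z powr (\<sigma> - b) * K z))"
    unfolding nonlocal_outer_eq
    by (intro set_integral_dominated(2) set_integral_add(1) integrable
        outer_increment_measurable[OF w(1)]) auto
  also have "\<dots> = A * kernel_moment (- ball 0 \<delta>) (\<sigma> - \<beta>)
      + 2 * M * (LINT z:- ball 0 \<delta>|lebesgue. indicator (- ball 0 1) z * K z)
      + norm p * kernel_moment (- ball 0 \<delta>) (\<sigma> - b)"
    unfolding kernel_moment_def set_integral_add(2)[OF integrable_sum integrable(3)]
      set_integral_add(2)[OF integrable(1,2)]
    by simp
  also have "(LINT z:- ball 0 \<delta>|lebesgue. indicator (- ball 0 1) z * K z) = kernel_tail 1"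
    by (simp add: kernel_tail_def set_lebesgue_integral_def absorb)
  finally show ?thesis .
qed

end

section \<open>Testing with paraboloids\<close>

definition paraboloid :: "'a::real_inner \<Rightarrow> real \<Rightarrow> 'a \<Rightarrow> real \<Rightarrow> real \<Rightarrow> real \<Rightarrow> 'a \<times> real \<Rightarrow> real" where
  "paraboloid x s p \<kappa> g G z =
     p \<bullet> (fst z - x) + \<kappa> * (norm (fst z - x))\<^sup>2 + g * (snd z - s) + G * (snd z - s)\<^sup>2"

lemma power2_norm_diff_expand:
  fixes x y c :: "'a::real_inner"
  shows "(norm (y - c))\<^sup>2 = (norm (x - c))\<^sup>2 + (2 *\<^sub>R (x - c)) \<bullet> (y - x) + (norm (y - x))\<^sup>2"
  by (simp add: power2_norm_eq_inner inner_diff_left inner_diff_right inner_commute)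

lemma C2_on_paraboloid: "C2_on S (paraboloid x s p \<kappa> g G)"
proof -
  define D where "D z = blinfun_inner_left (p + (2 * \<kappa>) *\<^sub>R (fst z - x), g + 2 * G * (snd z - s))"
    for z :: "'a \<times> real"
  define D2 where "D2 v = blinfun_inner_left ((2 * \<kappa>) *\<^sub>R fst v, 2 * G * snd v)" for v :: "'a \<times> real"
  have D2: "bounded_linear D2"
    unfolding D2_def
    by (intro bounded_linear_compose[OF bounded_linear_blinfun_inner_left] bounded_linear_Pair
        bounded_linear_const_scaleR bounded_linear_const_mult bounded_linear_fst bounded_linear_snd)
  have "(paraboloid x s p \<kappa> g G has_derivative blinfun_apply (D z)) (at z within S)" for z
    unfolding paraboloid_def [abs_def] D_def power2_norm_eq_inner
    by (auto intro!: derivative_eq_intros simp: inner_commute algebra_simps inner_add_left inner_diff_left)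
  moreover have "(D has_derivative blinfun_apply (Blinfun D2)) (at z within S)" for z
    unfolding bounded_linear_Blinfun_apply[OF D2] unfolding D_def [abs_def] D2_def
    by (rule bounded_linear.has_derivative[OF bounded_linear_blinfun_inner_left])
      (auto intro!: derivative_eq_intros)
  ultimately show ?thesis
    unfolding C2_on_def by (intro exI[of _ D] exI[of _ "\<lambda>_. Blinfun D2"]) simp
qed

lemma grad_paraboloid: "grad (\<lambda>y. paraboloid x s p \<kappa> g G (y, s)) x = p"
proof -
  have gderiv: "GDERIV (\<lambda>y. paraboloid x s p \<kappa> g G (y, s)) x :> p"
    unfolding gderiv_def paraboloid_def power2_norm_eq_inner
    by (auto intro!: derivative_eq_intros simp: inner_commute)
  show ?thesis
    unfolding grad_def
  proof (rule the_equality)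
    show "GDERIV (\<lambda>y. paraboloid x s p \<kappa> g G (y, s)) x :> p" by (rule gderiv)
    fix D assume "GDERIV (\<lambda>y. paraboloid x s p \<kappa> g G (y, s)) x :> D"
    then have "(\<lambda>h. h \<bullet> D) = (\<lambda>h. h \<bullet> p)"
      using gderiv unfolding gderiv_def by (rule has_derivative_unique)
    then show "D = p"
      by (metis vector_eq_rdot inner_commute)
  qed
qed

lemma vector_derivative_paraboloid:
  assumes "s \<in> {0<..T}"
  shows "vector_derivative (\<lambda>\<tau>. paraboloid x s p \<kappa> g G (x, \<tau>)) (at s within {0<..T}) = g"
proof (rule vector_derivative_within)
  have "s islimpt {0<..<s}"
    using assms by (intro islimpt_greaterThanLessThan2) auto
  then have "s islimpt {0<..T}"
    by (rule islimpt_subset) (use assms in auto)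
  then show "at s within {0<..T} \<noteq> bot"
    by (simp add: trivial_limit_within)
  have "((\<lambda>\<tau>. paraboloid x s p \<kappa> g G (x, \<tau>)) has_real_derivative g) (at s within {0<..T})"
    unfolding paraboloid_def by (auto intro!: derivative_eq_intros)
  then show "((\<lambda>\<tau>. paraboloid x s p \<kappa> g G (x, \<tau>)) has_vector_derivative g) (at s within {0<..T})"
    by (simp add: has_real_derivative_iff_has_vector_derivative)
qed

lemma one_le_powr_minus:
  fixes r q :: real
  shows "0 < r \<Longrightarrow> r \<le> 1 \<Longrightarrow> 0 \<le> q \<Longrightarrow> 1 \<le> r powr - q"
  using powr_mono'[of "- q" 0 r] by simp

context small_order_kernel
begin

text \<open>The sum \<open>I[B\<^sub>\<delta>](\<phi>,x) + I[B\<^sub>\<delta>\<^sup>c](w,p,x)\<close> for a paraboloid \<open>\<phi>\<close> with gradient \<open>p\<close> and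
  Hessian \<open>2\<kappa>\<close> at \<open>x\<close>.\<close>

definition tested_nonlocal :: "real \<Rightarrow> real \<Rightarrow> ('a \<Rightarrow> real) \<Rightarrow> 'a \<Rightarrow> 'a \<Rightarrow> real" where
  "tested_nonlocal \<delta> \<kappa> w p x =
     \<kappa> * kernel_moment (ball 0 \<delta>) 2 + drift \<delta> p + nonlocal_outer \<sigma> K \<delta> w p x"

lemma nonlocal_inner_paraboloid:
  assumes "0 < \<delta>"
  shows "nonlocal_inner \<sigma> K \<delta> (\<lambda>y. paraboloid x s p \<kappa> g G (y, s)) x
    = \<kappa> * kernel_moment (ball 0 \<delta>) 2 + drift \<delta> p"
proof -
  have "\<sigma> < 2" using order_le_one by simp
  then have second: "set_integrable lebesgue (ball 0 \<delta>) (\<lambda>z. \<kappa> * (norm z powr 2 * K z))"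
    by (rule kernel_moment_inside_ball) (intro set_integrable_mult_right, use assms in blast)
  have "nonlocal_inner \<sigma> K \<delta> (\<lambda>y. paraboloid x s p \<kappa> g G (y, s)) x
      = (LINT z:ball 0 \<delta>|lebesgue. \<kappa> * (norm z powr 2 * K z) + (1 - I_ind \<sigma>) * (p \<bullet> z) * K z)"
    unfolding nonlocal_inner_def grad_paraboloid
    by (simp add: paraboloid_def algebra_simps)
  also have "\<dots> = \<kappa> * kernel_moment (ball 0 \<delta>) 2 + drift \<delta> p"
    unfolding kernel_moment_def drift_def using set_integral_add(2)[OF second drift_integrable[OF assms]] by simp
  finally show ?thesis .
qed

lemma visc_lhs_paraboloid:
  assumes "0 < \<delta>" "s \<in> {0<..T}"
  shows "visc_lhs T \<sigma> K F \<delta> u (paraboloid x s p \<kappa> g G) x s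
    = g + F x p (tested_nonlocal \<delta> \<kappa> (\<lambda>y. u (y, s)) p x)"
  unfolding visc_lhs_def Let_def grad_paraboloid vector_derivative_paraboloid[OF assms(2)]
    nonlocal_inner_paraboloid[OF assms(1)] tested_nonlocal_def ..

lemma visc_subsolution_paraboloid:
  assumes u: "visc_subsolution T \<sigma> K F u" and \<delta>: "0 < \<delta>" "\<delta> < 1" and s: "s \<in> {0<..T}"
    and touch: "\<And>y \<tau>. \<tau> \<in> {0<..T} \<Longrightarrow> u (y, \<tau>) \<le> u (x, s) + paraboloid x s p \<kappa> g G (y, \<tau>)"
  shows "g + F x p (tested_nonlocal \<delta> \<kappa> (\<lambda>y. u (y, s)) p x) \<le> 0"
proof -
  have "\<forall>(y, \<tau>)\<in>(ball x \<delta> \<times> {s - \<delta><..<s + \<delta>}) \<inter> parabolic_domain T.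
      u (y, \<tau>) - paraboloid x s p \<kappa> g G (y, \<tau>) \<le> u (x, s) - paraboloid x s p \<kappa> g G (x, s)"
    using touch by (auto simp: parabolic_domain_def paraboloid_def algebra_simps)
  moreover have "(x, s) \<in> parabolic_domain T" using s by (simp add: parabolic_domain_def)
  ultimately have "visc_lhs T \<sigma> K F \<delta> u (paraboloid x s p \<kappa> g G) x s \<le> 0"
    using u \<delta> C2_on_paraboloid unfolding visc_subsolution_def by blast
  then show ?thesis unfolding visc_lhs_paraboloid[OF \<delta>(1) s] .
qed

lemma visc_supersolution_paraboloid:
  assumes v: "visc_supersolution T \<sigma> K F v" and \<delta>: "0 < \<delta>" "\<delta> < 1" and s: "s \<in> {0<..T}"
    and touch: "\<And>y \<tau>. \<tau> \<in> {0<..T} \<Longrightarrow> v (x, s) + paraboloid x s p \<kappa> g G (y, \<tau>) \<le> v (y, \<tau>)"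
  shows "0 \<le> g + F x p (tested_nonlocal \<delta> \<kappa> (\<lambda>y. v (y, s)) p x)"
proof -
  have "\<forall>(y, \<tau>)\<in>(ball x \<delta> \<times> {s - \<delta><..<s + \<delta>}) \<inter> parabolic_domain T.
      v (x, s) - paraboloid x s p \<kappa> g G (x, s) \<le> v (y, \<tau>) - paraboloid x s p \<kappa> g G (y, \<tau>)"
    using touch by (auto simp: parabolic_domain_def paraboloid_def algebra_simps)
  moreover have "(x, s) \<in> parabolic_domain T" using s by (simp add: parabolic_domain_def)
  ultimately have "0 \<le> visc_lhs T \<sigma> K F \<delta> v (paraboloid x s p \<kappa> g G) x s"
    using v \<delta> C2_on_paraboloid unfolding visc_supersolution_def by blast
  then show ?thesis unfolding visc_lhs_paraboloid[OF \<delta>(1) s] .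
qed

lemma tested_nonlocal_mono:
  assumes w1: "w1 \<in> borel_measurable borel" "\<And>y. \<bar>w1 y\<bar> \<le> B1"
    and w2: "w2 \<in> borel_measurable borel" "\<And>y. \<bar>w2 y\<bar> \<le> B2" and \<delta>: "0 < \<delta>"
    and increment_le: "\<And>z. w1 (x1 + z) - w1 x1 \<le> w2 (x2 + z) - w2 x2 + \<theta>"
  shows "tested_nonlocal \<delta> \<kappa>1 w1 p1 x1 \<le> tested_nonlocal \<delta> \<kappa>2 w2 p2 x2
    + (\<kappa>1 - \<kappa>2) * kernel_moment (ball 0 \<delta>) 2 + drift \<delta> (p1 - p2) + (\<theta> + norm (p1 - p2)) * kernel_tail \<delta>"
proof -
  have "outer_increment w1 p1 x1 z \<le> outer_increment w2 p2 x2 z + (\<theta> + norm (p1 - p2))" for z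
  proof -
    have "\<bar>I_ind \<sigma> * indicator (ball 0 1) z * ((p1 - p2) \<bullet> z)\<bar> \<le> norm (p1 - p2) * norm z powr 0"
      by (rule abs_compensator_le) simp
    also have "\<dots> \<le> norm (p1 - p2)" by simp
    finally show ?thesis
      using increment_le[of z] unfolding outer_increment_def inner_diff_left right_diff_distrib by linarith
  qed
  from nonlocal_outer_mono[OF w1 w2 \<delta> this] show ?thesis
    by (simp add: tested_nonlocal_def drift_diff[OF \<delta>] left_diff_distrib)
qed

lemma nonlocal_outer_bound:
  assumes pos: "0 \<le> A" "0 \<le> M" "0 < \<beta>" "0 < b"
  obtains D where "0 \<le> D" "\<And>\<delta> w p x. 0 < \<delta> \<Longrightarrow> \<delta> < 1 \<Longrightarrow> w \<in> borel_measurable borel \<Longrightarrow>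
    (\<And>y. \<bar>w y\<bar> \<le> M) \<Longrightarrow> (\<And>z. \<bar>w (x + z) - w x\<bar> \<le> A * norm z powr (1 - \<beta>)) \<Longrightarrow>
    \<bar>nonlocal_outer \<sigma> K \<delta> w p x\<bar> \<le> D * (norm p * \<delta> powr - b + \<delta> powr - \<beta>)"
proof -
  obtain S where S: "0 \<le> S" "\<And>\<delta>. 0 < \<delta> \<Longrightarrow> kernel_moment (- ball 0 \<delta>) (\<sigma> - \<beta>) \<le> S * \<delta> powr - \<beta>"
    using kernel_moment_outside_ball[OF pos(3)] by metis
  obtain S' where S': "0 \<le> S'" "\<And>\<delta>. 0 < \<delta> \<Longrightarrow> kernel_moment (- ball 0 \<delta>) (\<sigma> - b) \<le> S' * \<delta> powr - b"
    using kernel_moment_outside_ball[OF pos(4)] by metis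
  define E where "E = 2 * M * kernel_tail 1"
  have E: "0 \<le> E" using pos(2) kernel_tail_nonneg by (simp add: E_def)
  have nonneg: "0 \<le> A * S" using pos(1) S(1) by simp
  show ?thesis
  proof (rule that[of "A * S + E + S'"])
    fix \<delta> :: real and w :: "'a \<Rightarrow> real" and p x :: 'a
    assume \<delta>: "0 < \<delta>" "\<delta> < 1" and w: "w \<in> borel_measurable borel" "\<And>y. \<bar>w y\<bar> \<le> M"
      and holder: "\<And>z. \<bar>w (x + z) - w x\<bar> \<le> A * norm z powr (1 - \<beta>)"
    have "E * 1 \<le> E * \<delta> powr - \<beta>"
      using E \<delta> pos(3) by (intro mult_left_mono one_le_powr_minus) auto
    moreover have "A * kernel_moment (- ball 0 \<delta>) (\<sigma> - \<beta>) \<le> A * (S * \<delta> powr - \<beta>)"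
      using S(2) \<delta>(1) pos(1) by (intro mult_left_mono) auto
    moreover have "norm p * kernel_moment (- ball 0 \<delta>) (\<sigma> - b) \<le> norm p * (S' * \<delta> powr - b)"
      using S'(2) \<delta>(1) by (intro mult_left_mono) auto
    ultimately have "\<bar>nonlocal_outer \<sigma> K \<delta> w p x\<bar> \<le> (A * S + E) * \<delta> powr - \<beta> + S' * (norm p * \<delta> powr - b)"
      using abs_nonlocal_outer_le[OF w \<delta> holder pos(1,3,4), of p] by (simp add: E_def algebra_simps)
    also have "\<dots> \<le> (A * S + E + S') * \<delta> powr - \<beta> + (A * S + E + S') * (norm p * \<delta> powr - b)"
      using S'(1) E nonneg by (intro add_mono[OF mult_right_mono mult_right_mono]) auto
    finally show "\<bar>nonlocal_outer \<sigma> K \<delta> w p x\<bar> \<le> (A * S + E + S') * (norm p * \<delta> powr - b + \<delta> powr - \<beta>)"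
      by (simp add: distrib_left)
  qed (use S'(1) E nonneg in simp)
qed

lemma tested_nonlocal_bound:
  assumes pos: "0 \<le> A" "0 \<le> M" "0 < \<beta>" "0 < b"
  obtains D where "0 \<le> D" "\<And>\<delta> \<kappa> w p x. 0 < \<delta> \<Longrightarrow> \<delta> < 1 \<Longrightarrow> 0 \<le> \<kappa> \<Longrightarrow> w \<in> borel_measurable borel \<Longrightarrow>
    (\<And>y. \<bar>w y\<bar> \<le> M) \<Longrightarrow> (\<And>z. \<bar>w (x + z) - w x\<bar> \<le> A * norm z powr (1 - \<beta>)) \<Longrightarrow>
    \<bar>tested_nonlocal \<delta> \<kappa> w p x\<bar> \<le> D * (\<kappa> * \<delta> + norm p * \<delta> powr - b + \<delta> powr - \<beta>)"
proof -
  obtain C_moment where C_moment: "0 \<le> C_moment"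
    "\<And>\<delta>. 0 < \<delta> \<Longrightarrow> \<delta> \<le> 1 \<Longrightarrow> kernel_moment (ball 0 \<delta>) 2 \<le> C_moment * \<delta>"
    using kernel_second_moment_le by blast
  obtain C_drift where C_drift: "0 \<le> C_drift"
    "\<And>\<delta> p. 0 < \<delta> \<Longrightarrow> \<delta> \<le> 1 \<Longrightarrow> \<bar>drift \<delta> p\<bar> \<le> C_drift * norm p"
    using drift_dominated by metis
  obtain B where B: "0 \<le> B" "\<And>\<delta> w p x. 0 < \<delta> \<Longrightarrow> \<delta> < 1 \<Longrightarrow> w \<in> borel_measurable borel \<Longrightarrow>
    (\<And>y. \<bar>w y\<bar> \<le> M) \<Longrightarrow> (\<And>z. \<bar>w (x + z) - w x\<bar> \<le> A * norm z powr (1 - \<beta>)) \<Longrightarrow>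
    \<bar>nonlocal_outer \<sigma> K \<delta> w p x\<bar> \<le> B * (norm p * \<delta> powr - b + \<delta> powr - \<beta>)"
    using nonlocal_outer_bound[OF pos] by blast
  define D where "D = C_moment + C_drift + B"
  have D: "0 \<le> D" "C_moment \<le> D" "C_drift + B \<le> D" "B \<le> D"
    using C_moment(1) C_drift(1) B(1) by (simp_all add: D_def)
  show ?thesis
  proof (rule that[OF D(1)])
    fix \<delta> \<kappa> :: real and w :: "'a \<Rightarrow> real" and p x :: 'a
    assume \<delta>: "0 < \<delta>" "\<delta> < 1" and \<kappa>: "0 \<le> \<kappa>" and w: "w \<in> borel_measurable borel" "\<And>y. \<bar>w y\<bar> \<le> M"
      and holder: "\<And>z. \<bar>w (x + z) - w x\<bar> \<le> A * norm z powr (1 - \<beta>)"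
    have "\<bar>\<kappa> * kernel_moment (ball 0 \<delta>) 2\<bar> \<le> C_moment * (\<kappa> * \<delta>)"
      using mult_left_mono[OF C_moment(2) \<kappa>, of \<delta>] \<delta> \<kappa> kernel_moment_nonneg by (simp add: mult_ac abs_mult)
    moreover have "\<bar>drift \<delta> p\<bar> \<le> C_drift * (norm p * \<delta> powr - b)"
    proof -
      have "C_drift * (norm p * 1) \<le> C_drift * (norm p * \<delta> powr - b)"
        using \<delta> pos(4) C_drift(1) by (intro mult_left_mono one_le_powr_minus) auto
      then show ?thesis using C_drift(2)[of \<delta> p] \<delta> by simp
    qed
    ultimately have "\<bar>tested_nonlocal \<delta> \<kappa> w p x\<bar>
        \<le> C_moment * (\<kappa> * \<delta>) + (C_drift + B) * (norm p * \<delta> powr - b) + B * \<delta> powr - \<beta>"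
      using B(2)[OF \<delta> w holder, of p] unfolding tested_nonlocal_def distrib_right distrib_left by linarith
    also have "\<dots> \<le> D * (\<kappa> * \<delta>) + D * (norm p * \<delta> powr - b) + D * \<delta> powr - \<beta>"
      using D \<kappa> \<delta> by (intro add_mono mult_right_mono) auto
    finally show "\<bar>tested_nonlocal \<delta> \<kappa> w p x\<bar> \<le> D * (\<kappa> * \<delta> + norm p * \<delta> powr - b + \<delta> powr - \<beta>)"
      by (simp add: distrib_left)
  qed
qed

end

section \<open>Sup-convolution in time\<close>

text \<open>The sup-convolution is considered at times \<open>t \<ge> a\<close>; \<open>2 * M < G * a\<^sup>2\<close> keeps its optimal times
  within \<open>a\<close> of \<open>t\<close>, hence positive.\<close>

locale time_sup_convolution =
  fixes T M G a :: real and u :: "'a::euclidean_space \<times> real \<Rightarrow> real"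
  assumes u_usc: "usc_on (closed_parabolic_domain T) u"
    and u_bound: "\<And>x t. t \<in> {0..T} \<Longrightarrow> \<bar>u (x, t)\<bar> \<le> M"
    and a_pos: "0 < a" and a_le: "a \<le> T"
    and G_pos: "0 < G" and penalty_large: "2 * M < G * a\<^sup>2"
begin

definition sup_conv :: "'a \<times> real \<Rightarrow> real" where
  "sup_conv z = (SUP \<tau>\<in>{0..T}. u (fst z, \<tau>) - G * (\<tau> - snd z)\<^sup>2)"

lemma T_pos: "0 < T"
  using a_pos a_le by linarith

lemma M_nonneg: "0 \<le> M"
  using u_bound[of 0 0] T_pos by (simp add: order_trans[OF abs_ge_zero])

lemma penalized_usc: "usc_on (UNIV \<times> {0..T}) (\<lambda>(z, \<tau>). u (fst z, \<tau>) - G * (\<tau> - snd z)\<^sup>2)"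
proof -
  have "usc_on (UNIV \<times> {0..T}) (\<lambda>y. u (fst (fst y), snd y))"
    by (rule usc_on_compose[OF u_usc]) (auto intro!: continuous_intros simp: closed_parabolic_domain_def)
  moreover have "usc_on (UNIV \<times> {0..T}) (\<lambda>y. - (G * (snd y - snd (fst y))\<^sup>2))"
    by (intro continuous_imp_usc_on continuous_intros)
  ultimately have "usc_on (UNIV \<times> {0..T}) (\<lambda>y. u (fst (fst y), snd y) + - (G * (snd y - snd (fst y))\<^sup>2))"
    by (rule usc_on_add)
  then show ?thesis by (simp add: case_prod_unfold)
qed

lemma sup_conv_maximum:
  "\<exists>\<tau>\<in>{0..T}. sup_conv (x, t) = u (x, \<tau>) - G * (\<tau> - t)\<^sup>2 \<and>
    (\<forall>\<tau>'\<in>{0..T}. u (x, \<tau>') - G * (\<tau>' - t)\<^sup>2 \<le> u (x, \<tau>) - G * (\<tau> - t)\<^sup>2)"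
  using usc_on_slice_attains_SUP[OF _ _ penalized_usc, of "(x, t)"] T_pos by (simp add: sup_conv_def)

lemma sup_conv_attained:
  obtains \<tau> where "\<tau> \<in> {0..T}" "sup_conv (x, t) = u (x, \<tau>) - G * (\<tau> - t)\<^sup>2"
  using sup_conv_maximum by blast

lemma sup_conv_upper: "\<tau> \<in> {0..T} \<Longrightarrow> u (x, \<tau>) - G * (\<tau> - t)\<^sup>2 \<le> sup_conv (x, t)"
  using sup_conv_maximum[of x t] by auto

lemma sup_conv_usc: "usc_on UNIV sup_conv"
  using usc_on_SUP_compact[OF _ _ penalized_usc] T_pos by (simp add: sup_conv_def [abs_def])

lemma sup_conv_slice_usc: "usc_on UNIV (\<lambda>x. sup_conv (x, t))"
  by (rule usc_on_compose[OF sup_conv_usc]) (auto intro!: continuous_intros)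

lemma sup_conv_slice_measurable: "(\<lambda>x. sup_conv (x, t)) \<in> borel_measurable borel"
  by (rule usc_on_UNIV_borel_measurable[OF sup_conv_slice_usc])

lemma sup_conv_bound:
  assumes "t \<in> {0..T}"
  shows "\<bar>sup_conv (x, t)\<bar> \<le> M"
proof -
  obtain \<tau> where \<tau>: "\<tau> \<in> {0..T}" "sup_conv (x, t) = u (x, \<tau>) - G * (\<tau> - t)\<^sup>2"
    by (rule sup_conv_attained)
  have "0 \<le> G * (\<tau> - t)\<^sup>2" using G_pos by simp
  then have "sup_conv (x, t) \<le> M" using \<tau> u_bound[of \<tau> x] by linarith
  moreover have "- M \<le> sup_conv (x, t)"
    using sup_conv_upper[OF assms, of x t] u_bound[OF assms, of x] by simp
  ultimately show ?thesis by simp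
qed

lemma sup_conv_optimal_time_near:
  assumes "t \<in> {0..T}" "\<tau> \<in> {0..T}" "sup_conv (x, t) = u (x, \<tau>) - G * (\<tau> - t)\<^sup>2"
  shows "\<bar>\<tau> - t\<bar> < a"
proof -
  have "G * (\<tau> - t)\<^sup>2 = u (x, \<tau>) - sup_conv (x, t)" using assms(3) by simp
  also have "\<dots> \<le> 2 * M"
    using u_bound[OF assms(2), of x] sup_conv_bound[OF assms(1), of x] by linarith
  also have "\<dots> < G * a\<^sup>2" by (rule penalty_large)
  finally have "\<bar>\<tau> - t\<bar>\<^sup>2 < a\<^sup>2" using G_pos by simp
  then show ?thesis by (rule power2_less_imp_less) (use a_pos in simp)
qed

end

section \<open>Space regularity of coercive subsolutions\<close>

lemma powr_le_tangent_quadratic: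
  fixes r s q :: real
  assumes "0 < r" "0 \<le> s" "0 < q" "q \<le> 2"
  shows "s powr q \<le> r powr q + q / 2 * r powr (q - 2) * (s\<^sup>2 - r\<^sup>2)"
proof -
  have r_powr: "r powr (q - 2) * r\<^sup>2 = r powr q"
    using assms(1) by (simp add: powr_diff)
  have "s powr q * r powr (2 - q) \<le> q / 2 * s\<^sup>2 + (1 - q / 2) * r\<^sup>2"
  proof (cases "s = 0")
    case False
    then have "(s powr 2) powr (q / 2) * (r powr 2) powr (1 - q / 2)
        \<le> q / 2 * s powr 2 + (1 - q / 2) * r powr 2"
      using assms by (intro Youngs_inequality_0) auto
    moreover have "(s powr 2) powr (q / 2) = s powr q" "(r powr 2) powr (1 - q / 2) = r powr (2 - q)"
      unfolding powr_powr by (simp_all add: right_diff_distrib)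
    ultimately show ?thesis
      using assms by simp
  qed (use assms in simp)
  then have "r powr (q - 2) * (s powr q * r powr (2 - q))
      \<le> r powr (q - 2) * (q / 2 * s\<^sup>2 + (1 - q / 2) * r\<^sup>2)"
    by (intro mult_left_mono) auto
  moreover have "r powr (q - 2) * r powr (2 - q) = 1"
    using assms(1) by (simp flip: powr_add)
  ultimately show ?thesis
    using r_powr by (simp add: algebra_simps diff_divide_distrib)
qed

lemma powr_max_imp_paraboloid_above:
  fixes w :: "'a::real_inner \<Rightarrow> real"
  assumes max: "\<And>y'. w y' - L * norm (y' - x) powr \<alpha> \<le> w y - L * norm (y - x) powr \<alpha>"
    and "y \<noteq> x" "0 < \<alpha>" "\<alpha> \<le> 2" "0 \<le> L" and \<kappa>: "\<kappa> = L * \<alpha> / 2 * norm (y - x) powr (\<alpha> - 2)"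
  shows "w y' \<le> w y + ((2 * \<kappa>) *\<^sub>R (y - x)) \<bullet> (y' - y) + \<kappa> * (norm (y' - y))\<^sup>2"
proof -
  have "L * norm (y' - x) powr \<alpha> \<le> L * (norm (y - x) powr \<alpha>
      + \<alpha> / 2 * norm (y - x) powr (\<alpha> - 2) * ((norm (y' - x))\<^sup>2 - (norm (y - x))\<^sup>2))"
    using assms by (intro mult_left_mono powr_le_tangent_quadratic) auto
  also have "\<dots> = L * norm (y - x) powr \<alpha> + \<kappa> * ((2 *\<^sub>R (y - x)) \<bullet> (y' - y) + (norm (y' - y))\<^sup>2)"
    unfolding power2_norm_diff_expand[of y' x y] by (simp add: \<kappa> algebra_simps)
  finally show ?thesis using max[of y'] by (simp add: algebra_simps)
qed

lemma powr_dominates: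
  fixes B E k q :: real
  assumes "0 < k" "0 < q"
  obtains L where "B < L" "E < k * L powr q"
proof
  define L where "L = 1 + \<bar>B\<bar> + (1 + \<bar>E\<bar> / k) powr (1 / q)"
  have "0 \<le> (1 + \<bar>E\<bar> / k) powr (1 / q)" by simp
  then show "B < L" unfolding L_def by linarith
  have "1 + \<bar>E\<bar> / k = ((1 + \<bar>E\<bar> / k) powr (1 / q)) powr q"
    using assms by (simp add: powr_powr add_pos_nonneg)
  also have "\<dots> \<le> L powr q"
    using assms by (intro powr_mono2) (auto simp: L_def)
  finally have "k * (1 + \<bar>E\<bar> / k) \<le> k * L powr q"
    using assms(1) by (intro mult_left_mono) auto
  then show "E < k * L powr q"
    using assms(1) by (simp add: distrib_left)
qed

lemma sliding_slope_powers:
  fixes r L \<beta> m' \<alpha> b :: real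
  assumes r: "0 < r" "r < 1" and L: "0 \<le> L" and \<beta>: "0 < \<beta>" "\<beta> \<le> 1" and m': "1 < m'"
    and \<alpha>: "\<alpha> = 1 - \<beta> / m'" and b: "b = \<beta> - \<beta> / m'"
  shows "L * \<alpha> * r powr (\<alpha> - 1) * r powr - b \<le> L * r powr - \<beta>"
    and "L * \<alpha> * r powr (\<alpha> - 1) \<le> L * \<alpha> * r powr (\<alpha> - 1) * r powr - b"
    and "(L * \<alpha> * r powr (\<alpha> - 1)) powr m' = \<alpha> powr m' * L powr (m' - 1) * (L * r powr - \<beta>)"
proof -
  have "0 < \<beta> / m'" "\<beta> / m' < \<beta>" using \<beta> m' by (simp_all add: field_simps)
  then have bounds: "0 < \<alpha>" "\<alpha> \<le> 1" "0 < b" using \<beta> by (simp_all add: \<alpha> b)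
  have "L * \<alpha> * r powr (\<alpha> - 1) * r powr - b = L * \<alpha> * r powr (\<alpha> - 1 + - b)"
    by (simp only: powr_add mult.assoc)
  also have "\<alpha> - 1 + - b = - \<beta>" by (simp add: \<alpha> b)
  also have "L * \<alpha> * r powr - \<beta> \<le> L * r powr - \<beta>"
    using L bounds by (intro mult_right_mono) (auto simp: mult_left_le)
  finally show "L * \<alpha> * r powr (\<alpha> - 1) * r powr - b \<le> L * r powr - \<beta>" .
  have "L * \<alpha> * r powr (\<alpha> - 1) * 1 \<le> L * \<alpha> * r powr (\<alpha> - 1) * r powr - b"
    using r L bounds by (intro mult_left_mono one_le_powr_minus) auto
  then show "L * \<alpha> * r powr (\<alpha> - 1) \<le> L * \<alpha> * r powr (\<alpha> - 1) * r powr - b" by simp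
  have "(L * \<alpha> * r powr (\<alpha> - 1)) powr m' = L powr m' * \<alpha> powr m' * r powr ((\<alpha> - 1) * m')"
    using L bounds by (simp add: powr_mult powr_powr)
  also have "(\<alpha> - 1) * m' = - \<beta>" using m' by (simp add: \<alpha>)
  also have "L powr m' = L powr (m' - 1) * L powr 1" by (simp only: powr_add[symmetric]) simp
  finally show "(L * \<alpha> * r powr (\<alpha> - 1)) powr m' = \<alpha> powr m' * L powr (m' - 1) * (L * r powr - \<beta>)"
    using L by simp
qed

definition space_holder_on ::
    "real set \<Rightarrow> real \<Rightarrow> real \<Rightarrow> ('a::real_normed_vector \<times> real \<Rightarrow> real) \<Rightarrow> bool" where
  "space_holder_on I A \<gamma> w \<longleftrightarrow> (\<forall>t\<in>I. \<forall>x y. \<bar>w (y, t) - w (x, t)\<bar> \<le> A * norm (y - x) powr \<gamma>)"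

lemma space_holder_onD:
  "space_holder_on I A \<gamma> w \<Longrightarrow> t \<in> I \<Longrightarrow> \<bar>w (y, t) - w (x, t)\<bar> \<le> A * norm (y - x) powr \<gamma>"
  by (simp add: space_holder_on_def)

lemma space_holder_onI_upper:
  assumes "\<And>t x y. t \<in> I \<Longrightarrow> w (y, t) - w (x, t) \<le> A * norm (y - x) powr \<gamma>"
  shows "space_holder_on I A \<gamma> w"
  unfolding space_holder_on_def abs_le_iff using assms by (metis minus_diff_eq norm_minus_commute)

locale coercive_equation = small_order_kernel \<sigma> K Kb
  for \<sigma> :: real and K :: "'a::euclidean_space \<Rightarrow> real" and Kb :: real +
  fixes F :: "'a \<Rightarrow> 'a \<Rightarrow> real \<Rightarrow> real" and c C m' :: real
  assumes degenerate_elliptic: "\<And>x p l1 l2. l2 \<le> l1 \<Longrightarrow> F x p l1 \<le> F x p l2"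
    and superlinear: "1 < m'" and C_pos: "0 < C" and c_pos: "0 < c"
    and coercive: "\<And>x p l. c * norm p powr m' - C * (\<bar>l\<bar> + 1) \<le> F x p l"

locale regularized_subsolution = coercive_equation \<sigma> K Kb F c C m' + time_sup_convolution T M G a u
  for \<sigma> Kb c C m' T M G a :: real and K :: "'a::euclidean_space \<Rightarrow> real"
    and F :: "'a \<Rightarrow> 'a \<Rightarrow> real \<Rightarrow> real" and u :: "'a \<times> real \<Rightarrow> real" +
  assumes subsolution: "visc_subsolution T \<sigma> K F u"
begin

lemma sup_conv_subsolution:
  assumes t: "t \<in> {a..T}" and \<tau>: "\<tau> \<in> {0..T}" "sup_conv (x, t) = u (x, \<tau>) - G * (\<tau> - t)\<^sup>2"
    and \<delta>: "0 < \<delta>" "\<delta> < 1"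
    and touch: "\<And>y. sup_conv (y, t) \<le> sup_conv (x, t) + p \<bullet> (y - x) + \<kappa> * (norm (y - x))\<^sup>2"
  shows "2 * G * (\<tau> - t) + F x p (tested_nonlocal \<delta> \<kappa> (\<lambda>y. sup_conv (y, t)) p x) \<le> 0"
proof -
  have t0: "t \<in> {0..T}" using t a_pos by auto
  have \<tau>0: "\<tau> \<in> {0<..T}" using sup_conv_optimal_time_near[OF t0 \<tau>] t \<tau>(1) by auto
  have "u (y, s) \<le> u (x, \<tau>) + paraboloid x \<tau> p \<kappa> (2 * G * (\<tau> - t)) G (y, s)" if "s \<in> {0<..T}" for y s
  proof -
    have "u (y, s) - G * (s - t)\<^sup>2 \<le> sup_conv (y, t)" using that by (intro sup_conv_upper) auto
    also have "\<dots> \<le> u (x, \<tau>) - G * (\<tau> - t)\<^sup>2 + p \<bullet> (y - x) + \<kappa> * (norm (y - x))\<^sup>2"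
      using touch[of y] \<tau>(2) by simp
    finally show ?thesis
      by (simp add: paraboloid_def power2_eq_square algebra_simps)
  qed
  then have "2 * G * (\<tau> - t) + F x p (tested_nonlocal \<delta> \<kappa> (\<lambda>y. u (y, \<tau>)) p x) \<le> 0"
    by (rule visc_subsolution_paraboloid[OF subsolution \<delta> \<tau>0])
  moreover have "tested_nonlocal \<delta> \<kappa> (\<lambda>y. u (y, \<tau>)) p x \<le> tested_nonlocal \<delta> \<kappa> (\<lambda>y. sup_conv (y, t)) p x
      + (\<kappa> - \<kappa>) * kernel_moment (ball 0 \<delta>) 2 + drift \<delta> (p - p) + (0 + norm (p - p)) * kernel_tail \<delta>"
  proof (rule tested_nonlocal_mono[OF _ _ sup_conv_slice_measurable _ \<delta>(1)])
    show "(\<lambda>y. u (y, \<tau>)) \<in> borel_measurable borel"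
      by (intro usc_on_UNIV_borel_measurable usc_on_compose[OF u_usc])
        (use \<tau>(1) in \<open>auto intro!: continuous_intros simp: closed_parabolic_domain_def\<close>)
    show "\<bar>u (y, \<tau>)\<bar> \<le> M" "\<bar>sup_conv (y, t)\<bar> \<le> M" for y
      using u_bound[OF \<tau>(1)] sup_conv_bound[OF t0] by auto
    show "u (x + z, \<tau>) - u (x, \<tau>) \<le> sup_conv (x + z, t) - sup_conv (x, t) + 0" for z
      using sup_conv_upper[OF \<tau>(1), of "x + z" t] \<tau>(2) by simp
  qed
  then have "F x p (tested_nonlocal \<delta> \<kappa> (\<lambda>y. sup_conv (y, t)) p x)
      \<le> F x p (tested_nonlocal \<delta> \<kappa> (\<lambda>y. u (y, \<tau>)) p x)"
    by (intro degenerate_elliptic) (simp add: drift_zero)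
  ultimately show ?thesis by linarith
qed

lemma sup_conv_gradient_bound:
  assumes t: "t \<in> {a..T}" and \<delta>: "0 < \<delta>" "\<delta> < 1"
    and touch: "\<And>y. sup_conv (y, t) \<le> sup_conv (x, t) + p \<bullet> (y - x) + \<kappa> * (norm (y - x))\<^sup>2"
  shows "c * norm p powr m' \<le> C * (\<bar>tested_nonlocal \<delta> \<kappa> (\<lambda>y. sup_conv (y, t)) p x\<bar> + 1) + 2 * G * T"
proof -
  obtain \<tau> where \<tau>: "\<tau> \<in> {0..T}" "sup_conv (x, t) = u (x, \<tau>) - G * (\<tau> - t)\<^sup>2"
    by (rule sup_conv_attained)
  have "2 * G * (t - \<tau>) \<le> 2 * G * T"
    using t \<tau>(1) G_pos by (intro mult_left_mono) auto
  then show ?thesis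
    using sup_conv_subsolution[OF t \<tau> \<delta> touch]
      coercive[of p "tested_nonlocal \<delta> \<kappa> (\<lambda>y. sup_conv (y, t)) p x" x]
    by (simp add: right_diff_distrib)
qed

lemma sup_conv_sliding:
  assumes t: "t \<in> {a..T}" and L: "2 * M < L" and \<alpha>: "0 < \<alpha>" "\<alpha> \<le> 1"
    and steep: "L * norm (y - x) powr \<alpha> < sup_conv (y, t) - sup_conv (x, t)"
  obtains r \<kappa> p z where "0 < r" "r < 1" "0 \<le> \<kappa>"
    "norm p = L * \<alpha> * r powr (\<alpha> - 1)" "2 * (\<kappa> * r) = norm p"
    "c * norm p powr m' \<le> C * (\<bar>tested_nonlocal r \<kappa> (\<lambda>y. sup_conv (y, t)) p z\<bar> + 1) + 2 * G * T"
proof -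
  have "t \<in> {0..T}" using t a_pos by auto
  then obtain z where z: "norm (z - x) < 1" "\<And>y'. sup_conv (y', t) - L * norm (y' - x) powr \<alpha>
      \<le> sup_conv (z, t) - L * norm (z - x) powr \<alpha>"
    using usc_minus_powr_attains_sup[OF sup_conv_slice_usc sup_conv_bound L \<alpha>(1)] by metis
  have "z \<noteq> x" using z(2)[of y] steep by auto
  define r where "r = norm (z - x)"
  have r: "0 < r" "r < 1" using z(1) \<open>z \<noteq> x\<close> by (simp_all add: r_def)
  define \<kappa> where "\<kappa> = L * \<alpha> / 2 * r powr (\<alpha> - 2)"
  have "0 \<le> L" using L M_nonneg by linarith
  then have \<kappa>: "0 \<le> \<kappa>" using \<alpha> by (simp add: \<kappa>_def)
  define p where "p = (2 * \<kappa>) *\<^sub>R (z - x)"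
  have p: "2 * (\<kappa> * r) = norm p" using \<kappa> by (simp add: p_def r_def)
  also have "\<dots> = L * \<alpha> * (r powr (\<alpha> - 2) * r powr 1)" using r by (simp add: \<kappa>_def flip: p)
  also have "\<dots> = L * \<alpha> * r powr (\<alpha> - 1)" by (simp only: powr_add[symmetric]) simp
  finally have norm_p: "norm p = L * \<alpha> * r powr (\<alpha> - 1)" using p by simp
  have "sup_conv (y', t) \<le> sup_conv (z, t) + p \<bullet> (y' - z) + \<kappa> * (norm (y' - z))\<^sup>2" for y'
    unfolding p_def using z(2) \<open>z \<noteq> x\<close> \<alpha> \<open>0 \<le> L\<close>
    by (intro powr_max_imp_paraboloid_above) (auto simp: \<kappa>_def r_def)
  then show ?thesis
    by (intro that[OF r \<kappa> norm_p p] sup_conv_gradient_bound[OF t r])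
qed

definition nonlocal_growth :: "real \<Rightarrow> real \<Rightarrow> real \<Rightarrow> bool" where
  "nonlocal_growth D b \<beta> \<longleftrightarrow> (\<forall>\<delta> \<kappa> t p x. 0 < \<delta> \<longrightarrow> \<delta> < 1 \<longrightarrow> 0 \<le> \<kappa> \<longrightarrow> t \<in> {a..T} \<longrightarrow>
     \<bar>tested_nonlocal \<delta> \<kappa> (\<lambda>y. sup_conv (y, t)) p x\<bar>
       \<le> D * (\<kappa> * \<delta> + norm p * \<delta> powr - b + \<delta> powr - \<beta>))"

lemma nonlocal_growthD:
  assumes "nonlocal_growth D b \<beta>" "0 < \<delta>" "\<delta> < 1" "0 \<le> \<kappa>" "t \<in> {a..T}"
  shows "\<bar>tested_nonlocal \<delta> \<kappa> (\<lambda>y. sup_conv (y, t)) p x\<bar>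
    \<le> D * (\<kappa> * \<delta> + norm p * \<delta> powr - b + \<delta> powr - \<beta>)"
  using assms unfolding nonlocal_growth_def by blast

lemma space_holder_imp_nonlocal_growth:
  assumes holder: "space_holder_on {a..T} A (1 - \<beta>) sup_conv" and pos: "0 \<le> A" "0 < \<beta>" "0 < b"
  obtains D where "0 \<le> D" "nonlocal_growth D b \<beta>"
proof -
  obtain D where "0 \<le> D" and D: "\<And>\<delta> \<kappa> w p x. 0 < \<delta> \<Longrightarrow> \<delta> < 1 \<Longrightarrow> 0 \<le> \<kappa> \<Longrightarrow> w \<in> borel_measurable borel \<Longrightarrow>
    (\<And>y. \<bar>w y\<bar> \<le> M) \<Longrightarrow> (\<And>z. \<bar>w (x + z) - w x\<bar> \<le> A * norm z powr (1 - \<beta>)) \<Longrightarrow>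
    \<bar>tested_nonlocal \<delta> \<kappa> w p x\<bar> \<le> D * (\<kappa> * \<delta> + norm p * \<delta> powr - b + \<delta> powr - \<beta>)"
    using tested_nonlocal_bound[OF pos(1) M_nonneg pos(2,3)] by blast
  have "nonlocal_growth D b \<beta>"
    unfolding nonlocal_growth_def
  proof (intro allI impI)
    fix \<delta> \<kappa> t :: real and p x :: 'a
    assume "0 < \<delta>" "\<delta> < 1" "0 \<le> \<kappa>" and t: "t \<in> {a..T}"
    then show "\<bar>tested_nonlocal \<delta> \<kappa> (\<lambda>y. sup_conv (y, t)) p x\<bar>
        \<le> D * (\<kappa> * \<delta> + norm p * \<delta> powr - b + \<delta> powr - \<beta>)"
      using a_pos space_holder_onD[OF holder t, of "x + _" x]
      by (intro D sup_conv_slice_measurable sup_conv_bound) auto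
  qed
  with \<open>0 \<le> D\<close> show ?thesis by (rule that)
qed

lemma sup_conv_slope_bound:
  assumes D: "0 \<le> D" "nonlocal_growth D b \<beta>" and \<beta>: "0 < \<beta>" "\<beta> \<le> 1"
    and \<alpha>_eq: "\<alpha> = 1 - \<beta> / m'" and b_eq: "b = \<beta> - \<beta> / m'"
    and L: "1 < L" "2 * M < L" "C * (3 * D + 1) + 2 * G * T < c * \<alpha> powr m' * L powr (m' - 1)"
    and t: "t \<in> {a..T}"
  shows "sup_conv (y, t) - sup_conv (x, t) \<le> L * norm (y - x) powr \<alpha>"
proof (rule ccontr)
  have "0 < \<beta> / m'" "\<beta> / m' < \<beta>" using \<beta> superlinear by (simp_all add: field_simps)
  then have \<alpha>: "0 < \<alpha>" "\<alpha> \<le> 1" using \<beta> by (simp_all add: \<alpha>_eq)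
  have L0: "0 \<le> L" using L(1) by simp
  assume "\<not> ?thesis"
  then have steep: "L * norm (y - x) powr \<alpha> < sup_conv (y, t) - sup_conv (x, t)" by simp
  obtain r \<kappa> p z where r: "0 < r" "r < 1" and \<kappa>: "0 \<le> \<kappa>" "2 * (\<kappa> * r) = norm p"
    and p: "norm p = L * \<alpha> * r powr (\<alpha> - 1)"
    and bound: "c * norm p powr m'
      \<le> C * (\<bar>tested_nonlocal r \<kappa> (\<lambda>y. sup_conv (y, t)) p z\<bar> + 1) + 2 * G * T"
    by (rule sup_conv_sliding[OF t L(2) \<alpha> steep])
  define \<rho> where "\<rho> = r powr - \<beta>"
  note powers = sliding_slope_powers[OF r L0 \<beta> superlinear \<alpha>_eq b_eq, folded p \<rho>_def]
  have "1 \<le> \<rho>" unfolding \<rho>_def using r \<beta> by (intro one_le_powr_minus) auto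
  then have L\<rho>: "\<rho> \<le> L * \<rho>" "1 \<le> L * \<rho>" using L(1) mult_mono[of 1 L 1 \<rho>] by simp_all
  have "\<kappa> * r + norm p * r powr - b + \<rho> \<le> 3 * (L * \<rho>)"
    using \<kappa>(2) powers(1,2) L\<rho>(1) norm_ge_zero[of p] by linarith
  then have "D * (\<kappa> * r + norm p * r powr - b + \<rho>) \<le> D * (3 * (L * \<rho>))"
    using D(1) by (rule mult_left_mono)
  moreover have "\<bar>tested_nonlocal r \<kappa> (\<lambda>y. sup_conv (y, t)) p z\<bar>
      \<le> D * (\<kappa> * r + norm p * r powr - b + \<rho>)"
    unfolding \<rho>_def by (rule nonlocal_growthD[OF D(2) r \<kappa>(1) t])
  ultimately have "C * (\<bar>tested_nonlocal r \<kappa> (\<lambda>y. sup_conv (y, t)) p z\<bar> + 1)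
      \<le> C * (3 * D * (L * \<rho>) + L * \<rho>)"
    using C_pos L\<rho>(2) by (intro mult_left_mono) (auto simp: mult.assoc mult.left_commute)
  moreover have "2 * G * T * 1 \<le> 2 * G * T * (L * \<rho>)"
    using L\<rho>(2) G_pos T_pos by (intro mult_left_mono) auto
  ultimately have "c * norm p powr m' \<le> (C * (3 * D + 1) + 2 * G * T) * (L * \<rho>)"
    using bound by (simp add: algebra_simps)
  then have "c * \<alpha> powr m' * L powr (m' - 1) * (L * \<rho>) \<le> (C * (3 * D + 1) + 2 * G * T) * (L * \<rho>)"
    by (simp add: powers(3) mult.assoc)
  then show False using L(3) L\<rho>(2) by (simp add: mult_le_cancel_right)
qed

lemma sup_conv_holder_step:
  assumes holder: "space_holder_on {a..T} A (1 - \<beta>) sup_conv" and A: "0 \<le> A" and \<beta>: "0 < \<beta>" "\<beta> \<le> 1"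
  obtains L where "0 \<le> L" "space_holder_on {a..T} L (1 - \<beta> / m') sup_conv"
proof -
  define \<alpha> where "\<alpha> = 1 - \<beta> / m'"
  define b where "b = \<beta> - \<beta> / m'"
  have "\<beta> / m' < \<beta>" using \<beta> superlinear by (simp add: field_simps)
  then have \<alpha>: "0 < \<alpha>" and b: "0 < b" using \<beta> by (simp_all add: \<alpha>_def b_def)
  obtain D where D: "0 \<le> D" "nonlocal_growth D b \<beta>"
    by (rule space_holder_imp_nonlocal_growth[OF holder A \<beta>(1) b])
  obtain L where L: "max 1 (2 * M) < L" "C * (3 * D + 1) + 2 * G * T < c * \<alpha> powr m' * L powr (m' - 1)"
    by (rule powr_dominates[of "c * \<alpha> powr m'" "m' - 1" "max 1 (2 * M)" "C * (3 * D + 1) + 2 * G * T"])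
      (use superlinear c_pos \<alpha> in simp_all)
  have "space_holder_on {a..T} L \<alpha> sup_conv"
    using L by (intro space_holder_onI_upper sup_conv_slope_bound[OF D \<beta> \<alpha>_def b_def]) auto
  with L(1) show ?thesis
    unfolding \<alpha>_def by (intro that) auto
qed

lemma sup_conv_holder_almost_one:
  assumes "0 < \<epsilon>"
  obtains \<beta> A where "0 < \<beta>" "\<beta> \<le> \<epsilon>" "\<beta> \<le> 1" "0 \<le> A" "space_holder_on {a..T} A (1 - \<beta>) sup_conv"
proof -
  have iterate: "\<exists>A\<ge>0. space_holder_on {a..T} A (1 - (1 / m') ^ k) sup_conv" for k
  proof (induction k)
    case 0
    have "\<bar>sup_conv (y, t) - sup_conv (x, t)\<bar> \<le> 2 * M * norm (y - x) powr 0" if "t \<in> {a..T}" for t x y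
      using that a_pos sup_conv_bound[of t x] sup_conv_bound[of t y] by (cases "y = x") auto
    then show ?case
      using M_nonneg by (intro exI[of _ "2 * M"]) (simp add: space_holder_on_def)
  next
    case (Suc k)
    moreover have "0 < (1 / m') ^ k" "(1 / m') ^ k \<le> 1"
      using superlinear by (auto intro!: power_le_one)
    ultimately show ?case
      using sup_conv_holder_step[of _ "(1 / m') ^ k"]
      by (metis power_Suc2 times_divide_eq_right mult_1_right)
  qed
  obtain k where k: "(1 / m') ^ k < \<epsilon>"
    using real_arch_pow_inv[OF assms, of "1 / m'"] superlinear by auto
  obtain A where "0 \<le> A" "space_holder_on {a..T} A (1 - (1 / m') ^ k) sup_conv"
    using iterate by blast
  then show ?thesis
    using that[of "(1 / m') ^ k" A] k superlinear by (simp add: power_le_one)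
qed

end

section \<open>Doubling of variables\<close>

definition (in small_order_kernel) doubling_error :: "real \<Rightarrow> real \<Rightarrow> real \<Rightarrow> 'a \<Rightarrow> real" where
  "doubling_error H \<theta> \<delta> q =
     (2 * H + \<theta>) * kernel_moment (ball 0 \<delta>) 2 + drift \<delta> q + 3 * \<theta> * kernel_tail \<delta>"

locale sub_super_pair = regularized_subsolution \<sigma> Kb c C m' T M G a K F u
  for \<sigma> Kb c C m' T M G a :: real and K :: "'a::euclidean_space \<Rightarrow> real"
    and F :: "'a \<Rightarrow> 'a \<Rightarrow> real \<Rightarrow> real" and u :: "'a \<times> real \<Rightarrow> real" +
  fixes v :: "'a \<times> real \<Rightarrow> real"
  assumes supersolution: "visc_supersolution T \<sigma> K F v"
    and v_bound: "\<And>x t. t \<in> {0..T} \<Longrightarrow> \<bar>v (x, t)\<bar> \<le> M"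
begin

definition doubled :: "real \<Rightarrow> real \<Rightarrow> 'a \<times> 'a \<times> real \<Rightarrow> real" where
  "doubled H \<eta> = (\<lambda>(x, y, s). sup_conv (x, s) - v (y, s) - H * (norm (x - y))\<^sup>2 - \<eta> * s)"

definition doubling_maximum :: "real \<Rightarrow> real \<Rightarrow> real \<Rightarrow> 'a \<Rightarrow> 'a \<Rightarrow> 'a \<Rightarrow> real \<Rightarrow> bool" where
  "doubling_maximum H \<eta> \<theta> x1 x y s \<longleftrightarrow> norm (x - x1) < 1 \<and> s \<in> {0..T} \<and>
     (\<forall>x' y'. \<forall>s'\<in>{0..T}. doubled H \<eta> (x', y', s') - \<theta> * capped_sq_norm (x' - x1)
        \<le> doubled H \<eta> (x, y, s) - \<theta> * capped_sq_norm (x - x1))"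

lemma v_uminus_usc: "usc_on (closed_parabolic_domain T) (\<lambda>z. - v z)"
  using supersolution by (intro usc_on_uminus) (simp add: visc_supersolution_def)

lemma v_slice_measurable:
  assumes "s \<in> {0..T}"
  shows "(\<lambda>y. v (y, s)) \<in> borel_measurable borel"
proof -
  have "(\<lambda>y. - v (y, s)) \<in> borel_measurable borel"
    by (intro usc_on_UNIV_borel_measurable usc_on_compose[OF v_uminus_usc])
      (use assms in \<open>auto intro!: continuous_intros simp: closed_parabolic_domain_def\<close>)
  then show ?thesis by simp
qed

lemma doubled_usc: "usc_on (UNIV \<times> UNIV \<times> {0..T}) (doubled H \<eta>)"
proof -
  let ?D = "UNIV \<times> UNIV \<times> {0..T} :: ('a \<times> 'a \<times> real) set"
  have "usc_on ?D (\<lambda>z. sup_conv (fst z, snd (snd z)))"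
    by (rule usc_on_compose[OF sup_conv_usc]) (auto intro!: continuous_intros)
  moreover have "usc_on ?D (\<lambda>z. - v (snd z))"
    by (rule usc_on_compose[OF v_uminus_usc])
      (auto intro!: continuous_intros simp: closed_parabolic_domain_def)
  moreover have "usc_on ?D (\<lambda>z. - (H * (norm (fst z - fst (snd z)))\<^sup>2 + \<eta> * snd (snd z)))"
    by (intro continuous_imp_usc_on continuous_intros)
  ultimately have "usc_on ?D (\<lambda>z. sup_conv (fst z, snd (snd z)) + - v (snd z)
      + - (H * (norm (fst z - fst (snd z)))\<^sup>2 + \<eta> * snd (snd z)))"
    by (intro usc_on_add)
  then show ?thesis
    by (simp add: doubled_def case_prod_unfold diff_diff_eq add_diff_eq)
qed

lemma doubled_le:
  assumes "0 \<le> \<eta>" "s \<in> {0..T}"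
  shows "doubled H \<eta> (x, y, s) \<le> 2 * M - H * (norm (x - y))\<^sup>2"
proof -
  have "0 \<le> \<eta> * s" using assms by simp
  then show ?thesis
    using sup_conv_bound[OF assms(2), of x] v_bound[OF assms(2), of y] by (simp add: doubled_def)
qed

lemma doubled_coercive:
  assumes "0 < H" "0 \<le> \<eta>"
  shows "\<exists>B\<subseteq>UNIV \<times> {0..T}. compact B \<and>
    (\<forall>x'\<in>cball x 1. \<forall>z\<in>UNIV \<times> {0..T} - B. doubled H \<eta> (x', z) \<le> b)"
proof (intro exI conjI ballI)
  define q where "q = \<bar>2 * M - b\<bar> / H"
  have q: "0 \<le> q" using assms(1) by (simp add: q_def)
  show "cball x (2 + q) \<times> {0..T} \<subseteq> UNIV \<times> {0..T}" "compact (cball x (2 + q) \<times> {0..T})"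
    by (auto intro: compact_Times)
  fix x' z assume x': "x' \<in> cball x 1" and z: "z \<in> UNIV \<times> {0..T} - cball x (2 + q) \<times> {0..T}"
  obtain y s where ys: "z = (y, s)" "s \<in> {0..T}" "2 + q < dist x y" using z by (force simp: not_le)
  have "1 + q \<le> norm (x' - y)"
    using ys(3) x' dist_triangle[of x y x'] by (simp add: dist_norm)
  then have "(1 + q)\<^sup>2 \<le> (norm (x' - y))\<^sup>2" using q by (intro power_mono) auto
  moreover have "q \<le> (1 + q)\<^sup>2" using q by (simp add: power2_eq_square algebra_simps)
  ultimately have "H * q \<le> H * (norm (x' - y))\<^sup>2" using assms(1) by simp
  moreover have "H * q = \<bar>2 * M - b\<bar>" using assms(1) by (simp add: q_def)
  ultimately show "doubled H \<eta> (x', z) \<le> b"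
    using doubled_le[OF assms(2) ys(2), of H x' y] by (simp add: ys(1))
qed

lemma doubling_maximum_exists:
  assumes "0 < H" "0 \<le> \<eta>" "0 < \<theta>" "t0 \<in> {0..T}"
  obtains x1 x y s where "doubling_maximum H \<eta> \<theta> x1 x y s"
    "doubled H \<eta> (x0, y0, t0) - \<theta> \<le> doubled H \<eta> (x, y, s)"
proof -
  have "doubled H \<eta> z \<le> 2 * M" if mem: "z \<in> UNIV \<times> UNIV \<times> {0..T}" for z
  proof -
    obtain x y s where z: "z = (x, y, s)" "s \<in> {0..T}" using mem by auto
    have "0 \<le> H * (norm (x - y))\<^sup>2" using assms(1) by simp
    then show ?thesis using doubled_le[OF assms(2) z(2), of H x y] z(1) by simp
  qed
  then have bdd: "bdd_above (doubled H \<eta> ` (UNIV \<times> UNIV \<times> {0..T}))"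
    by (rule bdd_aboveI2)
  show ?thesis
  proof (rule usc_penalized_attains_sup[OF doubled_usc bdd assms(3) doubled_coercive[OF assms(1,2)]])
    show "(x0, y0, t0) \<in> UNIV \<times> UNIV \<times> {0..T}" using assms(4) by simp
    fix x1 x z
    assume z: "z \<in> UNIV \<times> {0..T}"
      and max: "norm (x - x1) < 1" "doubled H \<eta> (x0, y0, t0) - \<theta> \<le> doubled H \<eta> (x, z)"
        "\<And>x' z'. z' \<in> UNIV \<times> {0..T} \<Longrightarrow> doubled H \<eta> (x', z') - \<theta> * capped_sq_norm (x' - x1)
          \<le> doubled H \<eta> (x, z) - \<theta> * capped_sq_norm (x - x1)"
    obtain y s where "z = (y, s)" "s \<in> {0..T}" using z by auto
    with max show thesis
      by (intro that[of x1 x y s]) (auto simp: doubling_maximum_def)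
  qed
qed

lemma doubling_maximumD:
  assumes "doubling_maximum H \<eta> \<theta> x1 x y s" "s' \<in> {0..T}"
  shows "doubled H \<eta> (x', y', s') - \<theta> * capped_sq_norm (x' - x1)
    \<le> doubled H \<eta> (x, y, s) - \<theta> * capped_sq_norm (x - x1)"
  using assms unfolding doubling_maximum_def by blast

lemma doubling_maximum_slice:
  assumes "doubling_maximum H \<eta> \<theta> x1 x y s"
  shows "sup_conv (x', s) - v (y', s) - H * (norm (x' - y'))\<^sup>2 - \<theta> * capped_sq_norm (x' - x1)
    \<le> sup_conv (x, s) - v (y, s) - H * (norm (x - y))\<^sup>2 - \<theta> * capped_sq_norm (x - x1)"
proof -
  have "s \<in> {0..T}" using assms by (simp add: doubling_maximum_def)
  from doubling_maximumD[OF assms this, of x' y'] show ?thesis by (simp add: doubled_def)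
qed

lemma doubling_maximum_distance:
  assumes max: "doubling_maximum H \<eta> \<theta> x1 x y s" and \<theta>: "0 \<le> \<theta>"
  shows "H * (norm (x - y))\<^sup>2 \<le> sup_conv (x, s) - sup_conv (y, s) + \<theta>"
proof -
  have "\<theta> * capped_sq_norm (y - x1) \<le> \<theta> * 1" "0 \<le> \<theta> * capped_sq_norm (x - x1)"
    using \<theta> capped_sq_norm_bounds(1,2) by (auto intro: mult_left_le mult_nonneg_nonneg)
  then show ?thesis
    using doubling_maximum_slice[OF max, of y y] by simp
qed

lemma doubling_maximum_increment:
  assumes max: "doubling_maximum H \<eta> \<theta> x1 x y s" and \<theta>: "0 \<le> \<theta>"
  shows "sup_conv (x + z, s) - sup_conv (x, s) \<le> v (y + z, s) - v (y, s) + \<theta>"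
proof -
  have "\<theta> * capped_sq_norm (x + z - x1) \<le> \<theta> * 1" "0 \<le> \<theta> * capped_sq_norm (x - x1)"
    using \<theta> capped_sq_norm_bounds(1,2) by (auto intro: mult_left_le mult_nonneg_nonneg)
  then show ?thesis
    using doubling_maximum_slice[OF max, of "x + z" "y + z"] by simp
qed

lemma doubling_maximum_subsolution_test:
  assumes max: "doubling_maximum H \<eta> \<theta> x1 x y s" and \<theta>: "0 \<le> \<theta>"
  shows "sup_conv (x', s) \<le> sup_conv (x, s)
    + ((2 * H) *\<^sub>R (x - y) + (2 * \<theta>) *\<^sub>R (x - x1)) \<bullet> (x' - x) + (H + \<theta>) * (norm (x' - x))\<^sup>2"
proof -
  have "\<theta> * capped_sq_norm (x' - x1) \<le> \<theta> * (norm (x' - x1))\<^sup>2"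
    using \<theta> capped_sq_norm_bounds by (intro mult_left_mono) auto
  moreover have "capped_sq_norm (x - x1) = (norm (x - x1))\<^sup>2"
    using max by (intro capped_sq_norm_inside) (simp add: doubling_maximum_def)
  ultimately show ?thesis
    using doubling_maximum_slice[OF max, of x' y]
    unfolding power2_norm_diff_expand[of x' y x] power2_norm_diff_expand[of x' x1 x]
    by (simp add: inner_add_left algebra_simps)
qed

lemma doubling_maximum_supersolution_test:
  assumes max: "doubling_maximum H \<eta> \<theta> x1 x y s"
    and \<tau>: "\<tau> \<in> {0..T}" "sup_conv (x, s) = u (x, \<tau>) - G * (\<tau> - s)\<^sup>2" and s': "s' \<in> {0..T}"
  shows "v (y, s) + paraboloid y s ((2 * H) *\<^sub>R (x - y)) (- H) (2 * G * (\<tau> - s) - \<eta>) (- G) (y', s')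
    \<le> v (y', s')"
proof -
  have "(norm (x - y'))\<^sup>2 = (norm (x - y))\<^sup>2 - (2 *\<^sub>R (x - y)) \<bullet> (y' - y) + (norm (y' - y))\<^sup>2"
    using power2_norm_diff_expand[of y' x y]
    by (simp add: norm_minus_commute inner_diff_left inner_diff_right)
  then have "H * (norm (x - y'))\<^sup>2
      = H * (norm (x - y))\<^sup>2 - ((2 * H) *\<^sub>R (x - y)) \<bullet> (y' - y) + H * (norm (y' - y))\<^sup>2"
    by (simp add: distrib_left right_diff_distrib)
  moreover have "doubled H \<eta> (x, y', s') \<le> doubled H \<eta> (x, y, s)"
    using doubling_maximumD[OF max s', of x y'] by simp
  ultimately have "v (y, s) + ((2 * H) *\<^sub>R (x - y)) \<bullet> (y' - y) - H * (norm (y' - y))\<^sup>2 - \<eta> * (s' - s)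
      + sup_conv (x, s') - sup_conv (x, s) \<le> v (y', s')"
    by (simp add: doubled_def right_diff_distrib)
  moreover have "u (x, \<tau>) - G * (\<tau> - s')\<^sup>2 \<le> sup_conv (x, s')"
    by (rule sup_conv_upper[OF \<tau>(1)])
  moreover have "G * (\<tau> - s)\<^sup>2 - G * (\<tau> - s')\<^sup>2 = 2 * G * (\<tau> - s) * (s' - s) - G * (s' - s)\<^sup>2"
    by (simp add: power2_eq_square algebra_simps)
  ultimately show ?thesis
    using \<tau>(2) by (simp add: paraboloid_def left_diff_distrib)
qed

lemma doubling_maximum_inequality:
  assumes max: "doubling_maximum H \<eta> \<theta> x1 x y s" and s: "s \<in> {a..T}" and \<theta>: "0 \<le> \<theta>"
    and \<delta>: "0 < \<delta>" "\<delta> < 1"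
    and pv: "pv = (2 * H) *\<^sub>R (x - y)" and pu: "pu = pv + (2 * \<theta>) *\<^sub>R (x - x1)"
    and l: "l = tested_nonlocal \<delta> (H + \<theta>) (\<lambda>y. sup_conv (y, s)) pu x"
    and e: "doubling_error H \<theta> \<delta> (pu - pv) \<le> e"
  shows "\<eta> \<le> F y pv (l - e) - F x pu l"
proof -
  have s0: "s \<in> {0..T}" "s \<in> {0<..T}" using s a_pos by auto
  obtain \<tau> where \<tau>: "\<tau> \<in> {0..T}" "sup_conv (x, s) = u (x, \<tau>) - G * (\<tau> - s)\<^sup>2"
    by (rule sup_conv_attained)
  define k where "k = tested_nonlocal \<delta> (- H) (\<lambda>y. v (y, s)) pv y"
  have "2 * G * (\<tau> - s) + F x pu l \<le> 0"
    unfolding l pu pv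
    by (rule sup_conv_subsolution[OF s \<tau> \<delta> doubling_maximum_subsolution_test[OF max \<theta>]])
  moreover have "0 \<le> 2 * G * (\<tau> - s) - \<eta> + F y pv k"
    unfolding k_def pv
    by (rule visc_supersolution_paraboloid[OF supersolution \<delta> s0(2)
          doubling_maximum_supersolution_test[OF max \<tau>]]) simp
  moreover have "F y pv k \<le> F y pv (l - e)"
  proof (rule degenerate_elliptic)
    have "l \<le> k + (H + \<theta> - - H) * kernel_moment (ball 0 \<delta>) 2 + drift \<delta> (pu - pv)
        + (\<theta> + norm (pu - pv)) * kernel_tail \<delta>"
      unfolding l k_def
      by (rule tested_nonlocal_mono[OF sup_conv_slice_measurable sup_conv_bound[OF s0(1)]
            v_slice_measurable[OF s0(1)] v_bound[OF s0(1)] \<delta>(1) doubling_maximum_increment[OF max \<theta>]])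
    moreover have "norm (pu - pv) \<le> 2 * \<theta>"
      using max \<theta> by (simp add: pu doubling_maximum_def mult_left_le)
    then have "(\<theta> + norm (pu - pv)) * kernel_tail \<delta> \<le> 3 * \<theta> * kernel_tail \<delta>"
      by (intro mult_right_mono kernel_tail_nonneg) simp
    ultimately show "l - e \<le> k"
      using e by (simp add: doubling_error_def)
  qed
  ultimately show ?thesis by linarith
qed

end

section \<open>Estimates at the doubling scale\<close>

lemma doubling_gradient_bound:
  fixes d \<epsilon> A \<beta> :: real
  assumes \<epsilon>: "0 < \<epsilon>" "\<epsilon> \<le> 1" and \<beta>: "0 \<le> \<beta>" "\<beta> \<le> 1" and "0 \<le> A" "0 \<le> d"
    and dist_le: "d\<^sup>2 / \<epsilon>\<^sup>2 \<le> A * d powr (1 - \<beta>) + \<epsilon>\<^sup>2"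
  shows "d / \<epsilon>\<^sup>2 \<le> (A + 1) * \<epsilon> powr - (2 * \<beta>)"
proof (cases "d \<le> \<epsilon>\<^sup>2")
  case True
  then have "d / \<epsilon>\<^sup>2 \<le> 1 * 1" using \<epsilon> by simp
  also have "\<dots> \<le> (A + 1) * \<epsilon> powr - (2 * \<beta>)"
    using assms by (intro mult_mono one_le_powr_minus) auto
  finally show ?thesis .
next
  case False
  have \<epsilon>2: "0 < \<epsilon>\<^sup>2" "\<epsilon>\<^sup>2 \<le> 1" using \<epsilon> by (simp_all add: power_le_one)
  with False have d: "0 < d" "\<epsilon>\<^sup>2 \<le> d" by linarith+
  have "(\<epsilon>\<^sup>2) powr 1 \<le> (\<epsilon>\<^sup>2) powr (1 - \<beta>)" using \<epsilon>2 \<beta> by (intro powr_mono') auto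
  also have "\<dots> \<le> d powr (1 - \<beta>)" using d \<epsilon>2 \<beta> by (intro powr_mono2) auto
  finally have "d\<^sup>2 / \<epsilon>\<^sup>2 \<le> (A + 1) * d powr (1 - \<beta>)"
    using dist_le \<epsilon>2 by (simp add: distrib_right)
  also have "d powr (1 - \<beta>) = d powr - \<beta> * d"
    using d by (simp add: powr_diff powr_minus field_simps)
  finally have "d / \<epsilon>\<^sup>2 * d \<le> (A + 1) * d powr - \<beta> * d"
    by (simp add: power2_eq_square mult.assoc)
  then have "d / \<epsilon>\<^sup>2 \<le> (A + 1) * d powr - \<beta>"
    using d(1) by (simp only: mult_le_cancel_right_pos)
  also have "\<dots> \<le> (A + 1) * (\<epsilon>\<^sup>2) powr - \<beta>"
    using d \<epsilon>2 \<beta> \<open>0 \<le> A\<close> by (intro mult_left_mono powr_mono2') auto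
  also have "(\<epsilon>\<^sup>2) powr - \<beta> = \<epsilon> powr - (2 * \<beta>)"
    using \<epsilon> powr_powr[of \<epsilon> 2 "- \<beta>"] by simp
  finally show ?thesis .
qed

lemma cube_scale_bound:
  fixes \<epsilon> \<beta> P k q :: real
  assumes \<epsilon>: "0 < \<epsilon>" "\<epsilon> \<le> 1" and \<beta>: "0 \<le> \<beta>" and "k \<le> 2" and q: "q \<le> P * \<epsilon> powr - (2 * \<beta>)"
  shows "k + q * (\<epsilon> ^ 3) powr - \<beta> + (\<epsilon> ^ 3) powr - \<beta> \<le> (P + 3) * \<epsilon> powr - (5 * \<beta>)"
proof -
  have cube: "(\<epsilon> ^ 3) powr - \<beta> = \<epsilon> powr - (3 * \<beta>)"
    using \<epsilon> powr_powr[of \<epsilon> 3 "- \<beta>"] by simp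
  have "q * \<epsilon> powr - (3 * \<beta>) \<le> P * \<epsilon> powr - (2 * \<beta>) * \<epsilon> powr - (3 * \<beta>)"
    using q by (rule mult_right_mono) simp
  also have "\<dots> = P * \<epsilon> powr - (5 * \<beta>)"
    by (simp add: mult.assoc flip: powr_add)
  finally have "q * \<epsilon> powr - (3 * \<beta>) \<le> P * \<epsilon> powr - (5 * \<beta>)" .
  moreover have "\<epsilon> powr - (3 * \<beta>) \<le> \<epsilon> powr - (5 * \<beta>)"
    using \<epsilon> \<beta> by (intro powr_mono') auto
  moreover have "1 \<le> \<epsilon> powr - (5 * \<beta>)"
    using \<epsilon> \<beta> by (intro one_le_powr_minus) auto
  ultimately show ?thesis
    using \<open>k \<le> 2\<close> unfolding cube by (simp add: distrib_right)
qed

definition structure_weight :: "real \<Rightarrow> real \<Rightarrow> real \<Rightarrow> real \<Rightarrow> 'a::real_normed_vector \<Rightarrow> 'a \<Rightarrow> real" where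
  "structure_weight n m l1 l2 p1 p2 = (1 + max \<bar>l1\<bar> \<bar>l2\<bar> + max (norm p1) (norm p2) powr m) powr n"

definition structure_condition ::
    "(real \<Rightarrow> real) \<Rightarrow> real \<Rightarrow> real \<Rightarrow> ('a::real_normed_vector \<Rightarrow> 'a \<Rightarrow> real \<Rightarrow> real) \<Rightarrow> bool" where
  "structure_condition \<omega> n m F \<longleftrightarrow> (\<forall>x1 x2 p1 p2 l1 l2. \<bar>F x1 p1 l1 - F x2 p2 l2\<bar> \<le>
     \<omega> (\<bar>l1 - l2\<bar> + norm (x1 - x2) * structure_weight n m l1 l2 p1 p2
       + norm (p1 - p2) * structure_weight n m l1 l2 p1 p2))"

lemma structure_weight_le:
  assumes \<epsilon>: "0 < \<epsilon>" "\<epsilon> \<le> 1" and \<beta>: "0 \<le> \<beta>" and nm: "0 \<le> n" "0 \<le> m"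
    and small: "(5 + 2 * m) * \<beta> * n \<le> 1 / 2"
    and p: "0 \<le> P" "norm p1 \<le> P * \<epsilon> powr - (2 * \<beta>)" "norm p2 \<le> P * \<epsilon> powr - (2 * \<beta>)"
    and l: "0 \<le> D" "\<bar>l1\<bar> \<le> D * \<epsilon> powr - (5 * \<beta>)" "\<bar>l2\<bar> \<le> D * \<epsilon> powr - (5 * \<beta>)"
  shows "structure_weight n m l1 l2 p1 p2 \<le> (1 + D + P powr m) powr n * \<epsilon> powr - (1 / 2)"
proof -
  define X where "X = \<epsilon> powr - ((5 + 2 * m) * \<beta>)"
  have X: "\<epsilon> powr - (q * \<beta>) \<le> X" if "q \<le> 5 + 2 * m" for q
    unfolding X_def using that \<epsilon> \<beta> by (intro powr_mono') (auto intro: mult_right_mono)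
  have "1 \<le> X" using X[of 0] nm \<epsilon> by simp
  moreover have "max \<bar>l1\<bar> \<bar>l2\<bar> \<le> D * X"
    using l X[of 5] nm by (auto intro: order_trans[OF _ mult_left_mono])
  moreover have "max (norm p1) (norm p2) powr m \<le> P powr m * X"
  proof -
    have "max (norm p1) (norm p2) powr m \<le> (P * \<epsilon> powr - (2 * \<beta>)) powr m"
      using p nm by (intro powr_mono2) (auto simp: le_max_iff_disj)
    also have "\<dots> = P powr m * \<epsilon> powr - (2 * m * \<beta>)"
      using p(1) by (simp add: powr_mult powr_powr mult_ac)
    also have "\<dots> \<le> P powr m * X"
      using X[of "2 * m"] by (intro mult_left_mono) auto
    finally show ?thesis .
  qed
  ultimately have "1 + max \<bar>l1\<bar> \<bar>l2\<bar> + max (norm p1) (norm p2) powr m \<le> (1 + D + P powr m) * X"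
    unfolding distrib_right by linarith
  then have "structure_weight n m l1 l2 p1 p2 \<le> ((1 + D + P powr m) * X) powr n"
    unfolding structure_weight_def using nm
    by (intro powr_mono2) (auto simp: le_max_iff_disj intro!: add_nonneg_nonneg)
  also have "\<dots> = (1 + D + P powr m) powr n * \<epsilon> powr - ((5 + 2 * m) * \<beta> * n)"
    using l(1) by (simp add: X_def powr_mult powr_powr)
  also have "\<dots> \<le> (1 + D + P powr m) powr n * \<epsilon> powr - (1 / 2)"
    using \<epsilon> small by (intro mult_left_mono powr_mono') auto
  finally show ?thesis .
qed

lemma structure_argument_le:
  fixes \<epsilon> E B W Q e d q :: real
  assumes \<epsilon>: "0 < \<epsilon>" "\<epsilon> \<le> 1" and "0 \<le> e" "e \<le> E * \<epsilon>" "0 \<le> d" "d \<le> B * \<epsilon>" "0 \<le> q" "q \<le> 2 * \<epsilon>\<^sup>2"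
    and Q: "0 \<le> Q" "Q \<le> W * \<epsilon> powr - (1 / 2)"
  shows "e + d * Q + q * Q \<le> (E + (B + 2) * W) * sqrt \<epsilon>"
proof -
  have "\<epsilon>\<^sup>2 \<le> \<epsilon>" using \<epsilon> by (simp add: power2_eq_square mult_left_le)
  then have dq: "d + q \<le> (B + 2) * \<epsilon>" using assms by (simp add: distrib_right)
  have "(d + q) * Q \<le> (B + 2) * \<epsilon> * (W * \<epsilon> powr - (1 / 2))"
    using dq Q assms by (intro mult_mono) auto
  also have "\<dots> = (B + 2) * W * (\<epsilon> powr 1 * \<epsilon> powr - (1 / 2))" using \<epsilon> by simp
  also have "\<epsilon> powr 1 * \<epsilon> powr - (1 / 2) = sqrt \<epsilon>"
    using \<epsilon> by (simp only: powr_add[symmetric]) (simp add: powr_half_sqrt)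
  finally have "(d + q) * Q \<le> (B + 2) * W * sqrt \<epsilon>" .
  moreover have "e \<le> E * sqrt \<epsilon>"
  proof -
    have "0 \<le> E" using \<open>0 \<le> e\<close> \<open>e \<le> E * \<epsilon>\<close> \<epsilon>(1) zero_le_mult_iff[of E \<epsilon>] by linarith
    then have "E * \<epsilon> \<le> E * sqrt \<epsilon>"
      using \<open>\<epsilon>\<^sup>2 \<le> \<epsilon>\<close> by (intro mult_left_mono real_le_rsqrt)
    with \<open>e \<le> E * \<epsilon>\<close> show ?thesis by linarith
  qed
  ultimately show ?thesis by (simp add: distrib_right)
qed

lemma structure_condition_modulus_bound:
  assumes mod: "modulus_of_continuity \<omega>" and F: "structure_condition \<omega> n m F" and \<epsilon>: "0 < \<epsilon>" "\<epsilon> \<le> 1"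
    and "\<bar>l1 - l2\<bar> \<le> E * \<epsilon>" "norm (x1 - x2) \<le> B * \<epsilon>" "norm (p1 - p2) \<le> 2 * \<epsilon>\<^sup>2"
    and weight: "structure_weight n m l1 l2 p1 p2 \<le> W * \<epsilon> powr - (1 / 2)"
  shows "F x1 p1 l1 - F x2 p2 l2 \<le> \<omega> ((E + (B + 2) * W) * sqrt \<epsilon>)"
proof -
  define Q where "Q = structure_weight n m l1 l2 p1 p2"
  have Q: "0 \<le> Q" by (simp add: Q_def structure_weight_def)
  have argument_le: "\<bar>l1 - l2\<bar> + norm (x1 - x2) * Q + norm (p1 - p2) * Q \<le> (E + (B + 2) * W) * sqrt \<epsilon>"
    using assms Q by (intro structure_argument_le) (auto simp: Q_def)
  have nonneg: "0 \<le> \<bar>l1 - l2\<bar> + norm (x1 - x2) * Q + norm (p1 - p2) * Q"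
    using Q by simp
  have "F x1 p1 l1 - F x2 p2 l2 \<le> \<omega> (\<bar>l1 - l2\<bar> + norm (x1 - x2) * Q + norm (p1 - p2) * Q)"
    using F unfolding structure_condition_def Q_def by (meson abs_le_D1)
  also have "\<dots> \<le> \<omega> ((E + (B + 2) * W) * sqrt \<epsilon>)"
    using mod nonneg argument_le by (intro mono_onD[of "{0..}" \<omega>]) (auto simp: modulus_of_continuity_def)
  finally show ?thesis .
qed

lemma (in small_order_kernel) small_penalty_exists:
  assumes "0 < \<epsilon>" "0 < B"
  obtains \<theta> where "0 < \<theta>" "\<theta> \<le> \<epsilon>\<^sup>2" "\<theta> \<le> B" "\<theta> * kernel_tail \<delta> \<le> \<epsilon>"
proof -
  define \<theta> where "\<theta> = min (min (\<epsilon>\<^sup>2) (\<epsilon> / (1 + kernel_tail \<delta>))) B"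
  have tail: "0 < 1 + kernel_tail \<delta>" using kernel_tail_nonneg[of \<delta>] by simp
  then have pos: "0 < \<theta>" using assms by (simp add: \<theta>_def)
  have "\<theta> \<le> \<epsilon> / (1 + kernel_tail \<delta>)" and small: "\<theta> \<le> \<epsilon>\<^sup>2" "\<theta> \<le> B"
    unfolding \<theta>_def by linarith+
  then have "\<theta> * (1 + kernel_tail \<delta>) \<le> \<epsilon>" by (simp only: pos_le_divide_eq[OF tail])
  then have "\<theta> * kernel_tail \<delta> \<le> \<epsilon>" using pos by (simp add: distrib_left)
  with pos small show ?thesis by (rule that)
qed

lemma (in small_order_kernel) doubling_error_bound:
  obtains E where "0 \<le> E" "\<And>\<epsilon> \<theta> p. 0 < \<epsilon> \<Longrightarrow> \<epsilon> < 1 \<Longrightarrow> 0 \<le> \<theta> \<Longrightarrow> \<theta> \<le> \<epsilon>\<^sup>2 \<Longrightarrow>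
    \<theta> * kernel_tail (\<epsilon> ^ 3) \<le> \<epsilon> \<Longrightarrow> norm p \<le> 2 * \<theta> \<Longrightarrow>
    doubling_error (1 / \<epsilon>\<^sup>2) \<theta> (\<epsilon> ^ 3) p \<le> E * \<epsilon>"
proof -
  obtain C_moment where C_moment: "0 \<le> C_moment"
    "\<And>\<delta>. 0 < \<delta> \<Longrightarrow> \<delta> \<le> 1 \<Longrightarrow> kernel_moment (ball 0 \<delta>) 2 \<le> C_moment * \<delta>"
    using kernel_second_moment_le by blast
  obtain C_drift where C_drift: "0 \<le> C_drift"
    "\<And>\<delta> p. 0 < \<delta> \<Longrightarrow> \<delta> \<le> 1 \<Longrightarrow> \<bar>drift \<delta> p\<bar> \<le> C_drift * norm p"
    using drift_dominated by metis
  show ?thesis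
  proof (rule that[of "3 * C_moment + 2 * C_drift + 3"])
    fix \<epsilon> \<theta> :: real and p :: 'a
    assume \<epsilon>: "0 < \<epsilon>" "\<epsilon> < 1" and \<theta>: "0 \<le> \<theta>" "\<theta> \<le> \<epsilon>\<^sup>2" "\<theta> * kernel_tail (\<epsilon> ^ 3) \<le> \<epsilon>"
      and p: "norm p \<le> 2 * \<theta>"
    have cube: "0 < \<epsilon> ^ 3" "\<epsilon> ^ 3 \<le> 1" and sq: "\<epsilon>\<^sup>2 \<le> \<epsilon>" "\<epsilon>\<^sup>2 \<le> 1"
      using \<epsilon> power_decreasing[of 1 2 \<epsilon>] by (auto simp: power_le_one)
    have "\<theta> \<le> 1 / \<epsilon>\<^sup>2" using \<theta>(2) sq(2) \<epsilon>(1) by (simp add: order_trans)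
    then have "(2 * (1 / \<epsilon>\<^sup>2) + \<theta>) * kernel_moment (ball 0 (\<epsilon> ^ 3)) 2
        \<le> 3 * (1 / \<epsilon>\<^sup>2) * (C_moment * \<epsilon> ^ 3)"
      using C_moment(2)[OF cube] kernel_moment_nonneg \<theta>(1) by (intro mult_mono) auto
    also have "\<dots> = 3 * C_moment * \<epsilon>" using \<epsilon>(1) by (simp add: power2_eq_square power3_eq_cube)
    finally have "(2 * (1 / \<epsilon>\<^sup>2) + \<theta>) * kernel_moment (ball 0 (\<epsilon> ^ 3)) 2 \<le> 3 * C_moment * \<epsilon>" .
    moreover have "C_drift * norm p \<le> C_drift * (2 * \<epsilon>)"
      using p \<theta>(2) sq(1) C_drift(1) by (intro mult_left_mono) auto
    then have "drift (\<epsilon> ^ 3) p \<le> 2 * C_drift * \<epsilon>"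
      using C_drift(2)[OF cube, of p] by simp
    ultimately show "doubling_error (1 / \<epsilon>\<^sup>2) \<theta> (\<epsilon> ^ 3) p \<le> (3 * C_moment + 2 * C_drift + 3) * \<epsilon>"
      using \<theta>(3) by (simp add: doubling_error_def distrib_right)
  qed (use C_drift(1) C_moment(1) in simp)
qed

context sub_super_pair
begin

lemma doubling_maximum_location:
  assumes max: "doubling_maximum (1 / \<epsilon>\<^sup>2) \<eta> \<theta> x1 x y s" and "0 < \<epsilon>" "0 \<le> \<eta>" "0 \<le> S"
    and val: "S \<le> doubled (1 / \<epsilon>\<^sup>2) \<eta> (x, y, s)"
  shows "norm (x - y) \<le> sqrt (2 * M) * \<epsilon>" "S \<le> sup_conv (x, s) - v (y, s)"
proof -
  have s: "s \<in> {0..T}" using max by (simp add: doubling_maximum_def)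
  have "(norm (x - y))\<^sup>2 / \<epsilon>\<^sup>2 \<le> 2 * M"
    using doubled_le[OF \<open>0 \<le> \<eta>\<close> s, of "1 / \<epsilon>\<^sup>2" x y] val \<open>0 \<le> S\<close> by simp
  then have "(norm (x - y))\<^sup>2 \<le> 2 * M * \<epsilon>\<^sup>2" using \<open>0 < \<epsilon>\<close> by (simp add: field_simps)
  then have "norm (x - y) \<le> sqrt (2 * M * \<epsilon>\<^sup>2)" by (rule real_le_rsqrt)
  then show "norm (x - y) \<le> sqrt (2 * M) * \<epsilon>"
    using \<open>0 < \<epsilon>\<close> by (simp add: real_sqrt_mult)
  have "0 \<le> 1 / \<epsilon>\<^sup>2 * (norm (x - y))\<^sup>2" "0 \<le> \<eta> * s" using s \<open>0 \<le> \<eta>\<close> by simp_all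
  then show "S \<le> sup_conv (x, s) - v (y, s)"
    using val unfolding doubled_def prod.case by linarith
qed

lemma doubling_at_scale:
  assumes gap: "0 < S" "0 \<le> \<eta>" "t0 \<in> {0..T}" "S \<le> u (x0, t0) - v (x0, t0) - \<eta> * t0"
    and layer: "\<And>x y s. s \<in> {0..T} \<Longrightarrow> s < a \<Longrightarrow> norm (x - y) < \<rho> \<Longrightarrow> sup_conv (x, s) - v (y, s) < S / 2"
    and \<epsilon>: "0 < \<epsilon>" "\<epsilon> < 1" "sqrt (2 * M) * \<epsilon> < \<rho>"
    and err: "\<And>\<theta> p. 0 \<le> \<theta> \<Longrightarrow> \<theta> \<le> \<epsilon>\<^sup>2 \<Longrightarrow> \<theta> * kernel_tail (\<epsilon> ^ 3) \<le> \<epsilon> \<Longrightarrow> norm p \<le> 2 * \<theta> \<Longrightarrow>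
      doubling_error (1 / \<epsilon>\<^sup>2) \<theta> (\<epsilon> ^ 3) p \<le> e"
  obtains x y pu pv \<kappa> l s where "s \<in> {a..T}" "norm (x - y) \<le> sqrt (2 * M) * \<epsilon>"
    "(norm (x - y))\<^sup>2 / \<epsilon>\<^sup>2 \<le> sup_conv (x, s) - sup_conv (y, s) + \<epsilon>\<^sup>2"
    "norm pv = 2 * (norm (x - y) / \<epsilon>\<^sup>2)" "norm (pu - pv) \<le> 2 * \<epsilon>\<^sup>2" "0 \<le> \<kappa>" "\<kappa> * \<epsilon> ^ 3 \<le> 2"
    "l = tested_nonlocal (\<epsilon> ^ 3) \<kappa> (\<lambda>y. sup_conv (y, s)) pu x" "\<eta> \<le> F y pv (l - e) - F x pu l"
proof -
  obtain \<theta> where \<theta>: "0 < \<theta>" "\<theta> \<le> \<epsilon>\<^sup>2" "\<theta> \<le> S / 2" and \<theta>_tail: "\<theta> * kernel_tail (\<epsilon> ^ 3) \<le> \<epsilon>"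
    using small_penalty_exists[of \<epsilon> "S / 2"] \<epsilon>(1) gap(1) by auto
  have H: "0 < 1 / \<epsilon>\<^sup>2" using \<epsilon>(1) by simp
  obtain x1 x y s where max: "doubling_maximum (1 / \<epsilon>\<^sup>2) \<eta> \<theta> x1 x y s"
    and "doubled (1 / \<epsilon>\<^sup>2) \<eta> (x0, x0, t0) - \<theta> \<le> doubled (1 / \<epsilon>\<^sup>2) \<eta> (x, y, s)"
    by (rule doubling_maximum_exists[OF H gap(2) \<theta>(1) gap(3)])
  moreover have "S \<le> doubled (1 / \<epsilon>\<^sup>2) \<eta> (x0, x0, t0)"
    using gap(4) sup_conv_upper[OF gap(3), of x0 t0] by (simp add: doubled_def)
  ultimately have "S / 2 \<le> doubled (1 / \<epsilon>\<^sup>2) \<eta> (x, y, s)"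
    using \<theta>(3) by linarith
  then have near: "norm (x - y) \<le> sqrt (2 * M) * \<epsilon>" and "S / 2 \<le> sup_conv (x, s) - v (y, s)"
    using doubling_maximum_location[OF max \<epsilon>(1) gap(2), of "S / 2"] gap(1) by simp_all
  moreover have "s \<in> {0..T}" "norm (x - x1) < 1" using max by (simp_all add: doubling_maximum_def)
  ultimately have s: "s \<in> {a..T}" using layer[of s x y] \<epsilon>(3) by force
  have dist: "(norm (x - y))\<^sup>2 / \<epsilon>\<^sup>2 \<le> sup_conv (x, s) - sup_conv (y, s) + \<epsilon>\<^sup>2"
    using doubling_maximum_distance[OF max] \<theta> by simp
  define pv where "pv = (2 * (1 / \<epsilon>\<^sup>2)) *\<^sub>R (x - y)"
  define pu where "pu = pv + (2 * \<theta>) *\<^sub>R (x - x1)"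
  have pdiff: "norm (pu - pv) \<le> 2 * \<theta>"
    using \<open>norm (x - x1) < 1\<close> \<theta>(1) by (simp add: pu_def mult_left_le)
  have cube: "0 < \<epsilon> ^ 3" "\<epsilon> ^ 3 < 1" using \<epsilon> by (simp_all add: power_less_one_iff)
  have "\<eta> \<le> F y pv (tested_nonlocal (\<epsilon> ^ 3) (1 / \<epsilon>\<^sup>2 + \<theta>) (\<lambda>y. sup_conv (y, s)) pu x - e)
      - F x pu (tested_nonlocal (\<epsilon> ^ 3) (1 / \<epsilon>\<^sup>2 + \<theta>) (\<lambda>y. sup_conv (y, s)) pu x)"
    by (rule doubling_maximum_inequality[OF max s _ cube pv_def pu_def refl])
      (use \<theta> err[OF _ \<theta>(2) \<theta>_tail pdiff] in auto)
  moreover have "(1 / \<epsilon>\<^sup>2 + \<theta>) * \<epsilon> ^ 3 \<le> 2"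
  proof -
    have "(1 / \<epsilon>\<^sup>2 + \<theta>) * \<epsilon> ^ 3 = \<epsilon> + \<theta> * \<epsilon> ^ 3"
      using \<epsilon>(1) by (simp add: distrib_right power2_eq_square power3_eq_cube)
    also have "\<theta> * \<epsilon> ^ 3 \<le> 1 * 1"
      using \<theta> cube \<epsilon> power_le_one[of \<epsilon> 2] by (intro mult_mono) auto
    finally show ?thesis using \<epsilon>(2) by simp
  qed
  ultimately show ?thesis
    using pdiff \<theta> by (intro that[OF s near dist, of pv pu "1 / \<epsilon>\<^sup>2 + \<theta>"]) (auto simp: pv_def)
qed

lemma doubling_slopes_bound:
  assumes \<epsilon>: "0 < \<epsilon>" "\<epsilon> < 1" and \<beta>: "0 < \<beta>" "\<beta> \<le> 1" and A: "0 \<le> A"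
    and holder: "space_holder_on {a..T} A (1 - \<beta>) sup_conv" and s: "s \<in> {a..T}"
    and dist: "(norm (x - y))\<^sup>2 / \<epsilon>\<^sup>2 \<le> sup_conv (x, s) - sup_conv (y, s) + \<epsilon>\<^sup>2"
    and pv: "norm pv = 2 * (norm (x - y) / \<epsilon>\<^sup>2)" and pdiff: "norm (pu - pv) \<le> 2 * \<epsilon>\<^sup>2"
  shows "norm pv \<le> (2 * A + 4) * \<epsilon> powr - (2 * \<beta>)" "norm pu \<le> (2 * A + 4) * \<epsilon> powr - (2 * \<beta>)"
proof -
  have "norm (x - y) / \<epsilon>\<^sup>2 \<le> (A + 1) * \<epsilon> powr - (2 * \<beta>)"
    using dist space_holder_onD[OF holder s, of x y] \<epsilon> \<beta> A by (intro doubling_gradient_bound) auto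
  moreover have "\<epsilon>\<^sup>2 \<le> 1" "1 \<le> \<epsilon> powr - (2 * \<beta>)"
    using \<epsilon> \<beta> by (auto simp: power_le_one intro: one_le_powr_minus)
  ultimately show "norm pv \<le> (2 * A + 4) * \<epsilon> powr - (2 * \<beta>)" "norm pu \<le> (2 * A + 4) * \<epsilon> powr - (2 * \<beta>)"
    using pv pdiff norm_triangle_sub[of pu pv] by (simp_all add: distrib_right)
qed

lemma doubling_nonlocal_bound:
  assumes \<epsilon>: "0 < \<epsilon>" "\<epsilon> < 1" and \<beta>: "0 < \<beta>" and D: "0 \<le> D" "nonlocal_growth D \<beta> \<beta>"
    and \<kappa>: "0 \<le> \<kappa>" "\<kappa> * \<epsilon> ^ 3 \<le> 2" and s: "s \<in> {a..T}" and p: "norm p \<le> P * \<epsilon> powr - (2 * \<beta>)"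
  shows "\<bar>tested_nonlocal (\<epsilon> ^ 3) \<kappa> (\<lambda>y. sup_conv (y, s)) p x\<bar> \<le> D * (P + 3) * \<epsilon> powr - (5 * \<beta>)"
proof -
  have "\<bar>tested_nonlocal (\<epsilon> ^ 3) \<kappa> (\<lambda>y. sup_conv (y, s)) p x\<bar>
      \<le> D * (\<kappa> * \<epsilon> ^ 3 + norm p * (\<epsilon> ^ 3) powr - \<beta> + (\<epsilon> ^ 3) powr - \<beta>)"
    using \<epsilon> by (intro nonlocal_growthD[OF D(2)] \<kappa> s) (auto simp: power_less_one_iff)
  also have "\<dots> \<le> D * ((P + 3) * \<epsilon> powr - (5 * \<beta>))"
    using \<epsilon> \<beta> \<kappa>(2) p D(1) by (intro mult_left_mono cube_scale_bound) auto
  finally show ?thesis by (simp add: mult.assoc)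
qed

lemma doubling_modulus_bound:
  assumes nm: "0 < n" "0 \<le> m" and mod: "modulus_of_continuity \<omega>" and F: "structure_condition \<omega> n m F"
    and gap: "0 < S" "0 \<le> \<eta>" "t0 \<in> {0..T}" "S \<le> u (x0, t0) - v (x0, t0) - \<eta> * t0"
    and layer: "\<And>x y s. s \<in> {0..T} \<Longrightarrow> s < a \<Longrightarrow> norm (x - y) < \<rho> \<Longrightarrow> sup_conv (x, s) - v (y, s) < S / 2"
  obtains Z where "0 \<le> Z" "\<And>\<epsilon>. 0 < \<epsilon> \<Longrightarrow> \<epsilon> < 1 \<Longrightarrow> sqrt (2 * M) * \<epsilon> < \<rho> \<Longrightarrow> \<eta> \<le> \<omega> (Z * sqrt \<epsilon>)"
proof -
  have pos: "0 < 2 * n * (5 + 2 * m)" using nm by simp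
  then have "0 < 1 / (2 * n * (5 + 2 * m))" by simp
  then obtain \<beta> A where \<beta>: "0 < \<beta>" "\<beta> \<le> 1 / (2 * n * (5 + 2 * m))" "\<beta> \<le> 1" and A: "0 \<le> A"
    and holder: "space_holder_on {a..T} A (1 - \<beta>) sup_conv"
    by (rule sup_conv_holder_almost_one)
  have small: "(5 + 2 * m) * \<beta> * n \<le> 1 / 2"
    using \<beta>(2) unfolding pos_le_divide_eq[OF pos] by (simp add: mult_ac)
  obtain D where D: "0 \<le> D" "nonlocal_growth D \<beta> \<beta>"
    by (rule space_holder_imp_nonlocal_growth[OF holder A \<beta>(1,1)])
  obtain E where E: "0 \<le> E" "\<And>\<epsilon> \<theta> p. 0 < \<epsilon> \<Longrightarrow> \<epsilon> < 1 \<Longrightarrow> 0 \<le> \<theta> \<Longrightarrow> \<theta> \<le> \<epsilon>\<^sup>2 \<Longrightarrow>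
    \<theta> * kernel_tail (\<epsilon> ^ 3) \<le> \<epsilon> \<Longrightarrow> norm p \<le> 2 * \<theta> \<Longrightarrow>
    doubling_error (1 / \<epsilon>\<^sup>2) \<theta> (\<epsilon> ^ 3) p \<le> E * \<epsilon>"
    using doubling_error_bound by blast
  define P where "P = 2 * A + 4"
  have P: "0 \<le> P" using A by (simp add: P_def)
  define W where "W = (1 + (D * (P + 3) + E) + P powr m) powr n"
  show ?thesis
  proof (rule that[of "E + (sqrt (2 * M) + 2) * W"])
    show "0 \<le> E + (sqrt (2 * M) + 2) * W" using E(1) M_nonneg by (simp add: W_def)
    fix \<epsilon> :: real assume \<epsilon>: "0 < \<epsilon>" "\<epsilon> < 1" "sqrt (2 * M) * \<epsilon> < \<rho>"
    obtain x y pu pv \<kappa> l s where s: "s \<in> {a..T}" and near: "norm (x - y) \<le> sqrt (2 * M) * \<epsilon>"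
      and dist: "(norm (x - y))\<^sup>2 / \<epsilon>\<^sup>2 \<le> sup_conv (x, s) - sup_conv (y, s) + \<epsilon>\<^sup>2"
      and pv: "norm pv = 2 * (norm (x - y) / \<epsilon>\<^sup>2)" and pdiff: "norm (pu - pv) \<le> 2 * \<epsilon>\<^sup>2"
      and \<kappa>: "0 \<le> \<kappa>" "\<kappa> * \<epsilon> ^ 3 \<le> 2" and l: "l = tested_nonlocal (\<epsilon> ^ 3) \<kappa> (\<lambda>y. sup_conv (y, s)) pu x"
      and ineq: "\<eta> \<le> F y pv (l - E * \<epsilon>) - F x pu l"
      by (rule doubling_at_scale[OF gap layer \<epsilon> E(2)[OF \<epsilon>(1,2)]])
    have p: "norm pv \<le> P * \<epsilon> powr - (2 * \<beta>)" "norm pu \<le> P * \<epsilon> powr - (2 * \<beta>)"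
      unfolding P_def by (rule doubling_slopes_bound[OF \<epsilon>(1,2) \<beta>(1,3) A holder s dist pv pdiff])+
    have "\<bar>l\<bar> \<le> D * (P + 3) * \<epsilon> powr - (5 * \<beta>)"
      unfolding l by (rule doubling_nonlocal_bound[OF \<epsilon>(1,2) \<beta>(1) D \<kappa> s p(2)])
    moreover have "E * \<epsilon> \<le> E * \<epsilon> powr - (5 * \<beta>)"
      using \<epsilon> \<beta> E(1) one_le_powr_minus[of \<epsilon> "5 * \<beta>"] by (intro mult_left_mono) auto
    moreover have "0 \<le> E * \<epsilon>" using \<epsilon> E(1) by simp
    ultimately have l_le: "\<bar>l - E * \<epsilon>\<bar> \<le> (D * (P + 3) + E) * \<epsilon> powr - (5 * \<beta>)"
      "\<bar>l\<bar> \<le> (D * (P + 3) + E) * \<epsilon> powr - (5 * \<beta>)"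
      by (auto simp: distrib_right)
    have "structure_weight n m (l - E * \<epsilon>) l pv pu \<le> W * \<epsilon> powr - (1 / 2)"
      unfolding W_def using \<epsilon> \<beta> nm small p l_le D(1) E(1) P by (intro structure_weight_le) auto
    then have "F y pv (l - E * \<epsilon>) - F x pu l \<le> \<omega> ((E + (sqrt (2 * M) + 2) * W) * sqrt \<epsilon>)"
      using \<epsilon> E(1) near pdiff
      by (intro structure_condition_modulus_bound[OF mod F]) (auto simp: norm_minus_commute)
    with ineq show "\<eta> \<le> \<omega> ((E + (sqrt (2 * M) + 2) * W) * sqrt \<epsilon>)" by linarith
  qed
qed

lemma doubling_contradiction:
  assumes nm: "0 < n" "0 \<le> m" and mod: "modulus_of_continuity \<omega>" and F: "structure_condition \<omega> n m F"
    and gap: "0 < S" "0 < \<eta>" "t0 \<in> {0..T}" "S \<le> u (x0, t0) - v (x0, t0) - \<eta> * t0" and \<rho>: "0 < \<rho>"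
    and layer: "\<And>x y s. s \<in> {0..T} \<Longrightarrow> s < a \<Longrightarrow> norm (x - y) < \<rho> \<Longrightarrow> sup_conv (x, s) - v (y, s) < S / 2"
  shows False
proof -
  obtain Z where Z: "0 \<le> Z" "\<And>\<epsilon>. 0 < \<epsilon> \<Longrightarrow> \<epsilon> < 1 \<Longrightarrow> sqrt (2 * M) * \<epsilon> < \<rho> \<Longrightarrow> \<eta> \<le> \<omega> (Z * sqrt \<epsilon>)"
    using doubling_modulus_bound[OF nm mod F gap(1) less_imp_le[OF gap(2)] gap(3,4) layer] by blast
  obtain r where r: "0 < r" "\<And>t. 0 \<le> t \<Longrightarrow> t < r \<Longrightarrow> \<omega> t < \<eta>"
    using modulus_of_continuity_small[OF mod gap(2)] by blast
  have "((\<lambda>\<epsilon>. Z * sqrt \<epsilon>) \<longlongrightarrow> Z * sqrt 0) (at_right 0)"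
    "((\<lambda>\<epsilon>. sqrt (2 * M) * \<epsilon>) \<longlongrightarrow> sqrt (2 * M) * 0) (at_right 0)" "((\<lambda>\<epsilon>::real. \<epsilon>) \<longlongrightarrow> 0) (at_right 0)"
    by (intro tendsto_intros)+
  then have "\<forall>\<^sub>F \<epsilon> in at_right 0. Z * sqrt \<epsilon> < r" "\<forall>\<^sub>F \<epsilon> in at_right 0. sqrt (2 * M) * \<epsilon> < \<rho>"
    "\<forall>\<^sub>F \<epsilon> in at_right (0::real). \<epsilon> < 1"
    using r(1) \<rho> by (auto intro: order_tendstoD)
  then have "\<forall>\<^sub>F \<epsilon> in at_right 0. 0 < \<epsilon> \<and> \<epsilon> < 1 \<and> sqrt (2 * M) * \<epsilon> < \<rho> \<and> Z * sqrt \<epsilon> < r"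
    using eventually_at_right_less[of "0::real"] by eventually_elim simp
  then obtain \<epsilon> where \<epsilon>: "0 < \<epsilon>" "\<epsilon> < 1" "sqrt (2 * M) * \<epsilon> < \<rho>" "Z * sqrt \<epsilon> < r"
    using eventually_happens'[OF trivial_limit_at_right_real] by blast
  have "\<eta> \<le> \<omega> (Z * sqrt \<epsilon>)" by (rule Z(2)[OF \<epsilon>(1-3)])
  also have "\<dots> < \<eta>" using Z(1) \<epsilon>(1,4) by (intro r(2)) auto
  finally show False by simp
qed

lemma initial_layer_gap:
  assumes u0: "attains_initial_with T u0 \<omega>0 u" "attains_initial_with T u0 \<omega>0 v"
    and small: "\<And>t. 0 \<le> t \<Longrightarrow> t < 2 * a \<Longrightarrow> \<omega>0 t < e" "\<bar>u0 x - u0 y\<bar> < e"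
    and s: "s \<in> {0..T}" "s < a"
  shows "sup_conv (x, s) - v (y, s) < 3 * e"
proof -
  obtain \<tau> where \<tau>: "\<tau> \<in> {0..T}" "sup_conv (x, s) = u (x, \<tau>) - G * (\<tau> - s)\<^sup>2"
    by (rule sup_conv_attained)
  then have "\<tau> < 2 * a" using sup_conv_optimal_time_near[OF s(1) \<tau>] s(2) by linarith
  then have "\<omega>0 \<tau> < e" "\<omega>0 s < e" using small(1) \<tau>(1) s by auto
  moreover have "\<bar>u (x, \<tau>) - u0 x\<bar> \<le> \<omega>0 \<tau>" "\<bar>v (y, s) - u0 y\<bar> \<le> \<omega>0 s"
    using u0 \<tau>(1) s(1) by (auto simp: attains_initial_with_def)
  moreover have "0 \<le> G * (\<tau> - s)\<^sup>2" using G_pos by simp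
  ultimately show ?thesis using \<tau>(2) small(2) by linarith
qed

end

section \<open>Comparison and uniqueness\<close>

locale structured_equation = coercive_equation \<sigma> K Kb F c C m'
  for \<sigma> :: real and K :: "'a::euclidean_space \<Rightarrow> real" and Kb :: real
    and F :: "'a \<Rightarrow> 'a \<Rightarrow> real \<Rightarrow> real" and c C m' :: real +
  fixes \<omega> :: "real \<Rightarrow> real" and n m :: real
  assumes n_pos: "0 < n" and m_nonneg: "0 \<le> m"
    and modulus: "modulus_of_continuity \<omega>" and structural: "structure_condition \<omega> n m F"
begin

lemma comparison:
  assumes "0 < T" and u0: "uniformly_continuous_on UNIV u0"
    and sub: "visc_subsolution T \<sigma> K F u" and super: "visc_supersolution T \<sigma> K F v"
    and mod: "modulus_of_continuity \<omega>0"
    and init: "attains_initial_with T u0 \<omega>0 u" "attains_initial_with T u0 \<omega>0 v"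
    and z: "z \<in> closed_parabolic_domain T"
  shows "u z \<le> v z"
proof (rule ccontr)
  assume "\<not> u z \<le> v z"
  define S where "S = (u z - v z) / 2"
  define \<eta> where "\<eta> = S / T"
  have S: "0 < S" "0 < \<eta>" using \<open>\<not> u z \<le> v z\<close> \<open>0 < T\<close> by (simp_all add: S_def \<eta>_def)
  obtain x0 t0 where z_eq: "z = (x0, t0)" and t0: "t0 \<in> {0..T}"
    using z by (auto simp: closed_parabolic_domain_def)
  have "\<eta> * t0 \<le> \<eta> * T" using S t0 by (intro mult_left_mono) auto
  then have gap: "S \<le> u (x0, t0) - v (x0, t0) - \<eta> * t0"
    using \<open>0 < T\<close> by (simp add: \<eta>_def S_def z_eq)
  have "bounded (u ` closed_parabolic_domain T \<union> v ` closed_parabolic_domain T)"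
    using sub super by (simp add: visc_subsolution_def visc_supersolution_def)
  then obtain M where M: "\<And>x t. t \<in> {0..T} \<Longrightarrow> \<bar>u (x, t)\<bar> \<le> M" "\<And>x t. t \<in> {0..T} \<Longrightarrow> \<bar>v (x, t)\<bar> \<le> M"
    unfolding bounded_iff by (fastforce simp: closed_parabolic_domain_def)
  obtain r where r: "0 < r" "\<And>t. 0 \<le> t \<Longrightarrow> t < r \<Longrightarrow> \<omega>0 t < S / 6"
    using modulus_of_continuity_small[OF mod, of "S / 6"] S(1) by auto
  obtain \<rho> where \<rho>: "0 < \<rho>" "\<And>x y. dist x y < \<rho> \<Longrightarrow> dist (u0 x) (u0 y) < S / 6"
    using u0[unfolded uniformly_continuous_on_def, rule_format, of "S / 6"] S(1) by auto
  define a where "a = min T (r / 2)"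
  define G where "G = (2 * M + 1) / a\<^sup>2"
  have a: "0 < a" "a \<le> T" "2 * a \<le> r" using r(1) \<open>0 < T\<close> by (auto simp: a_def)
  have "0 \<le> M" using M(1)[OF t0, of x0] by linarith
  then have G: "0 < G" "2 * M < G * a\<^sup>2" using a(1) by (simp_all add: G_def)
  have usc: "usc_on (closed_parabolic_domain T) u" using sub by (simp add: visc_subsolution_def)
  interpret sub_super_pair \<sigma> Kb c C m' T M G a K F u v
    by unfold_locales (fact usc sub super M a G)+
  have "sup_conv (x, s) - v (y, s) < S / 2" if "s \<in> {0..T}" "s < a" "norm (x - y) < \<rho>" for x y s
    using initial_layer_gap[OF init _ _ that(1,2), of "S / 6" x y] r(2) a(3) \<rho>(2)[of x y] that(3)
    by (simp add: dist_norm)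
  then show False
    by (rule doubling_contradiction[OF n_pos m_nonneg modulus structural S t0 gap \<rho>(1)])
qed

lemma cauchy_visc_solution_unique:
  assumes "0 < T" "uniformly_continuous_on UNIV u0"
    and u: "cauchy_visc_solution T \<sigma> K F u0 u" "modulus_of_continuity \<omega>1"
      "attains_initial_with T u0 \<omega>1 u"
    and v: "cauchy_visc_solution T \<sigma> K F u0 v" "modulus_of_continuity \<omega>2"
      "attains_initial_with T u0 \<omega>2 v"
    and z: "z \<in> closed_parabolic_domain T"
  shows "u z = v z"
proof -
  let ?\<omega> = "\<lambda>t. \<omega>1 t + \<omega>2 t"
  have mod: "modulus_of_continuity ?\<omega>"
    by (intro modulus_of_continuity_add u(2) v(2))
  have init: "attains_initial_with T u0 ?\<omega> u"
    by (rule attains_initial_with_mono[OF u(3)]) (use v(2) in \<open>simp add: modulus_of_continuity_def\<close>)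
  have init': "attains_initial_with T u0 ?\<omega> v"
    by (rule attains_initial_with_mono[OF v(3)]) (use u(2) in \<open>simp add: modulus_of_continuity_def\<close>)
  have "visc_subsolution T \<sigma> K F u" "visc_supersolution T \<sigma> K F u"
    "visc_subsolution T \<sigma> K F v" "visc_supersolution T \<sigma> K F v"
    using u(1) v(1) by (simp_all add: cauchy_visc_solution_def visc_solution_def)
  then show ?thesis
    using comparison[OF assms(1,2) _ _ mod init init' z] comparison[OF assms(1,2) _ _ mod init' init z]
    by (intro order_antisym)
qed

end

lemma kernel_bound_of_bounded_ratio:
  fixes K k :: "'a::real_normed_vector \<Rightarrow> real"
  assumes "bounded (range k)" "\<And>z. z \<noteq> 0 \<Longrightarrow> k z = K z * norm z powr q"
  obtains B where "\<And>z. z \<noteq> 0 \<Longrightarrow> K z \<le> B * norm z powr - q"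
proof -
  obtain B where B: "\<And>z. \<bar>k z\<bar> \<le> B"
    using assms(1) by (auto simp: bounded_iff)
  have "K z \<le> B * norm z powr - q" if "z \<noteq> 0" for z
  proof -
    have "K z = k z * norm z powr - q"
      using assms(2)[OF that] that by (simp add: mult.assoc flip: powr_add)
    also have "\<dots> \<le> B * norm z powr - q"
      using B[of z] by (intro mult_right_mono) auto
    finally show ?thesis .
  qed
  then show ?thesis by (rule that)
qed

theorem theorem3p2:
  fixes T \<sigma> n m m' C c :: real
    and K kbar :: "'a::euclidean_space \<Rightarrow> real"
    and F :: "'a \<Rightarrow> 'a \<Rightarrow> real \<Rightarrow> real"
    and \<omega> :: "real \<Rightarrow> real"
    and u0 :: "'a \<Rightarrow> real"
  assumes "0 < T"
    and "0 < \<sigma>" and "\<sigma> \<le> 1"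
    and "\<And>z. 0 \<le> K z"
    and "K \<in> borel_measurable lebesgue"
    and "\<And>z. z \<noteq> 0 \<Longrightarrow> kbar z = K z * norm z powr (real DIM('a) + \<sigma>)"
    and "bounded (range kbar)"
    and "isCont kbar 0"
    and "0 < kbar 0"
    and "continuous_on UNIV (\<lambda>(x, p, l). F x p l)"
    and "0 < n" and "1 < m"
    and "modulus_of_continuity \<omega>"
    and "\<And>x1 x2 p1 p2 l1 l2.
      \<bar>F x1 p1 l1 - F x2 p2 l2\<bar> \<le>
        \<omega> (\<bar>l1 - l2\<bar>
          + norm (x1 - x2) *
              (1 + max \<bar>l1\<bar> \<bar>l2\<bar> + (max (norm p1) (norm p2)) powr m) powr n
          + norm (p1 - p2) *
              (1 + max \<bar>l1\<bar> \<bar>l2\<bar> + (max (norm p1) (norm p2)) powr m) powr n)"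
    and "\<And>x p l1 l2. l2 \<le> l1 \<Longrightarrow> F x p l1 \<le> F x p l2"
    and "1 < m'" and "0 < C" and "0 < c"
    and "\<And>x p l. c * norm p powr m' - C * (\<bar>l\<bar> + 1) \<le> F x p l"
    and "bounded (range u0)"
    and "uniformly_continuous_on UNIV u0"
  shows
    "(\<forall>u_lower u_upper \<omega>0.
        visc_supersolution T \<sigma> K F u_lower \<and> visc_subsolution T \<sigma> K F u_upper \<and>
        modulus_of_continuity \<omega>0 \<and>
        attains_initial_with T u0 \<omega>0 u_lower \<and> attains_initial_with T u0 \<omega>0 u_upper \<longrightarrow>
        (\<forall>z \<in> closed_parabolic_domain T. u_upper z \<le> u_lower z)) \<and>
     (\<forall>u v.
        cauchy_visc_solution T \<sigma> K F u0 u \<and>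
        (\<exists>\<omega>0. modulus_of_continuity \<omega>0 \<and> attains_initial_with T u0 \<omega>0 u) \<and>
        cauchy_visc_solution T \<sigma> K F u0 v \<and>
        (\<exists>\<omega>0. modulus_of_continuity \<omega>0 \<and> attains_initial_with T u0 \<omega>0 v) \<longrightarrow>
        (\<forall>z \<in> closed_parabolic_domain T. u z = v z))"
proof -
  obtain Kb where K_le: "\<And>z. z \<noteq> 0 \<Longrightarrow> K z \<le> Kb * norm z powr - (real DIM('a) + \<sigma>)"
    using kernel_bound_of_bounded_ratio[OF assms(7,6)] by blast
  have F: "structure_condition \<omega> n m F"
    using assms(14) by (simp add: structure_condition_def structure_weight_def)
  have m: "0 \<le> m" using assms(12) by simp
  interpret structured_equation \<sigma> K Kb F c C m' \<omega> n m
    by unfold_locales (fact assms K_le F m)+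
  show ?thesis
    using comparison[OF \<open>0 < T\<close> assms(21)] cauchy_visc_solution_unique[OF \<open>0 < T\<close> assms(21)] by blast
qed

end
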